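(* Let $p>1$ and let $\Gamma=(G,\sigma)$ be a connected signed graph with $\sigma\equiv-1$, $G=(V,E)$ and $|V|=n$. For any eigenfunction $f$ corresponding to the $n$-th variational eigenvalue $\lambda_n$ of $\Delta_p^\sigma$, the following hold: (i) $f$ is either strictly positive or strictly negative, i.e., either $f(x)>0$ for all $x\in V$ or $f(x)<0$ for all $x\in V$; (ii) for any other eigenfunction $g$ corresponding to $\lambda_n$, there exists a constant $c\in\mathbb R\setminus\{0\}$ such that $g=cf$; (iii) if $g$ is an eigenfunction corresponding to an eigenvalue $\lambda$ of $\Delta_p^\sigma$, and $g(x)>0$ for all $x\in V$ or $g(x)<0$ for all $x\in V$, then $\lambda=\lambda_n$.
   Context: Setting. $G=(V,E)$ is a finite simple undirected graph, $n=|V|$, with edge measure $w:E\to(0,\infty)$, vertex weight $\mu:V\to(0,\infty)$, potential $\kappa:V\to\mathbb R$ and signature $\sigma:E\to\{-1,1\}$; $\Gamma=(G,\sigma)$ is a signed graph, connected if $G$ is. Values are written $w_{xy},\sigma_{xy},\mu_x,\kappa_x$, and $x\sim y$ means $\{x,y\}\in E$. Put $\Phi_p(t)=|t|^{p-2}t$ for $t\neq0$ and $\Phi_p(0)=0$. For $p>1$, $\Delta_p^\sigma f(x)=\sum_{y\sim x}w_{xy}\Phi_p(f(x)-\sigma_{xy}f(y))+\kappa_x\Phi_p(f(x))$, and a nonzero $f:V\to\mathbb R$ is an eigenfunction with eigenvalue $\lambda\in\mathbb R$ if $\Delta_p^\sigma f(x)=\lambda\mu_x\Phi_p(f(x))$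 for all $x\in V$. Variational eigenvalues. $\mathcal S_p=\{f\in\mathbb R^V:\sum_x\mu_x|f(x)|^p=1\}$. For a compact set $S=-S$ its index (Krasnoselskii genus) $\gamma(S)$ is $0$ if $S=\emptyset$, otherwise the least positive integer $k$ for which an odd continuous map $S\to\mathbb R^k\setminus\{0\}$ exists ($\infty$ if none). $\mathcal F_k(\mathcal S_p)$ is the family of compact $A=-A\subset\mathcal S_p$ with $\gamma(A)\ge k$. With $\mathcal R_p^\sigma(f)=\frac{\sum_{\{x,y\}\in E}w_{xy}|f(x)-\sigma_{xy}f(y)|^p+\sum_{x\in V}\kappa_x|f(x)|^p}{\sum_{x\in V}\mu_x|f(x)|^p}$, the variational eigenvalues are $\lambda_k=\inf_{S\in\mathcal F_k(\mathcal S_p)}\sup_{f\in S}\mathcal R_p^\sigma(f)$, $k=1,\dots,n$. *)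

theory Defs
  imports "HOL-Analysis.Analysis"
begin

text \<open>
  The vertex set is the whole finite type \<open>'v\<close>, so functions on the vertices are
  vectors in \<open>real ^ 'v\<close>. Edges are two-element sets of vertices. The edge measure \<open>w\<close> and the
  signature \<open>\<sigma>\<close> are total functions on vertex sets, of which only the values on \<open>E\<close> matter.
\<close>

definition weighted_signed_graph ::
  "'v::finite set set \<Rightarrow> ('v set \<Rightarrow> real) \<Rightarrow> ('v \<Rightarrow> real) \<Rightarrow> ('v set \<Rightarrow> real) \<Rightarrow> bool"
  where "weighted_signed_graph E w \<mu> \<sigma> \<longleftrightarrow>
    (\<forall>e\<in>E. card e = 2) \<and> (\<forall>e\<in>E. w e > 0) \<and> (\<forall>x. \<mu> x > 0) \<and> (\<forall>e\<in>E. \<sigma> e \<in> {-1, 1})"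

definition connected_graph :: "'v::finite set set \<Rightarrow> bool"
  where "connected_graph E \<longleftrightarrow> (\<forall>x y. (\<lambda>u v. {u, v} \<in> E)\<^sup>*\<^sup>* x y)"

definition \<Phi> :: "real \<Rightarrow> real \<Rightarrow> real"
  where "\<Phi> p t = (if t = 0 then 0 else \<bar>t\<bar> powr (p - 2) * t)"

definition p_laplacian ::
  "real \<Rightarrow> 'v::finite set set \<Rightarrow> ('v set \<Rightarrow> real) \<Rightarrow> ('v \<Rightarrow> real) \<Rightarrow> ('v set \<Rightarrow> real)
    \<Rightarrow> real ^ 'v \<Rightarrow> 'v \<Rightarrow> real"
  where "p_laplacian p E w \<kappa> \<sigma> f x =
    (\<Sum>y | {x, y} \<in> E. w {x, y} * \<Phi> p (f $ x - \<sigma> {x, y} * f $ y)) + \<kappa> x * \<Phi> p (f $ x)"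

definition eigenfunction ::
  "real \<Rightarrow> 'v::finite set set \<Rightarrow> ('v set \<Rightarrow> real) \<Rightarrow> ('v \<Rightarrow> real) \<Rightarrow> ('v \<Rightarrow> real)
    \<Rightarrow> ('v set \<Rightarrow> real) \<Rightarrow> real \<Rightarrow> real ^ 'v \<Rightarrow> bool"
  where "eigenfunction p E w \<mu> \<kappa> \<sigma> ev f \<longleftrightarrow>
    f \<noteq> 0 \<and> (\<forall>x. p_laplacian p E w \<kappa> \<sigma> f x = ev * \<mu> x * \<Phi> p (f $ x))"

text \<open>
  Every edge occurs in the double sum once for each orientation, hence the factor \<open>1/2\<close>; since
  \<open>\<sigma>\<close> has values in \<open>{-1, 1}\<close>, both orientations contribute the same amount.
\<close>

definition rayleigh_quotient ::
  "real \<Rightarrow> 'v::finite set set \<Rightarrow> ('v set \<Rightarrow> real) \<Rightarrow> ('v \<Rightarrow> real) \<Rightarrow> ('v \<Rightarrow> real)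
    \<Rightarrow> ('v set \<Rightarrow> real) \<Rightarrow> real ^ 'v \<Rightarrow> real"
  where "rayleigh_quotient p E w \<mu> \<kappa> \<sigma> f =
    ((1/2) * (\<Sum>x\<in>UNIV. \<Sum>y | {x, y} \<in> E. w {x, y} * \<bar>f $ x - \<sigma> {x, y} * f $ y\<bar> powr p)
      + (\<Sum>x\<in>UNIV. \<kappa> x * \<bar>f $ x\<bar> powr p))
    / (\<Sum>x\<in>UNIV. \<mu> x * \<bar>f $ x\<bar> powr p)"

definition unit_p_sphere :: "real \<Rightarrow> ('v::finite \<Rightarrow> real) \<Rightarrow> (real ^ 'v) set"
  where "unit_p_sphere p \<mu> = {f. (\<Sum>x\<in>UNIV. \<mu> x * \<bar>f $ x\<bar> powr p) = 1}"

text \<open>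
  \<open>Euclidean_space k\<close> consists of the sequences that vanish from index \<open>k\<close> on; its origin is
  \<open>\<lambda>i. 0\<close>. In the genus, the infimum over the empty set is \<open>\<infinity>\<close>.
\<close>

definition odd_map_into_punctured :: "nat \<Rightarrow> (real ^ 'v::finite) set \<Rightarrow> (real ^ 'v \<Rightarrow> nat \<Rightarrow> real) \<Rightarrow> bool"
  where "odd_map_into_punctured k S h \<longleftrightarrow>
    continuous_map (top_of_set S) (Euclidean_space k) h \<and>
    (\<forall>f\<in>S. h f \<noteq> (\<lambda>i. 0)) \<and> (\<forall>f\<in>S. \<forall>i. h (- f) i = - h f i)"

definition genus :: "(real ^ 'v::finite) set \<Rightarrow> enat"
  where "genus S =
    (if S = {} then 0 else Inf {enat k | k. k > 0 \<and> (\<exists>h. odd_map_into_punctured k S h)})"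

definition genus_family :: "real \<Rightarrow> ('v::finite \<Rightarrow> real) \<Rightarrow> nat \<Rightarrow> (real ^ 'v) set set"
  where "genus_family p \<mu> k =
    {A. compact A \<and> uminus ` A = A \<and> A \<subseteq> unit_p_sphere p \<mu> \<and> genus A \<ge> enat k}"

definition variational_eigenvalue ::
  "real \<Rightarrow> 'v::finite set set \<Rightarrow> ('v set \<Rightarrow> real) \<Rightarrow> ('v \<Rightarrow> real) \<Rightarrow> ('v \<Rightarrow> real)
    \<Rightarrow> ('v set \<Rightarrow> real) \<Rightarrow> nat \<Rightarrow> real"
  where "variational_eigenvalue p E w \<mu> \<kappa> \<sigma> k =
    (INF S\<in>genus_family p \<mu> k. SUP f\<in>S. rayleigh_quotient p E w \<mu> \<kappa> \<sigma> f)"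

end

theory Submission
  imports Defs "HOL-Homology.Invariance_of_Domain"
begin

text \<open>
  Call the numerator of the Rayleigh quotient the energy, and for a number \<open>ev\<close> let the excess of
  \<open>f\<close> be its energy minus \<open>ev\<close> times \<open>\<Sum>x. \<mu> x * \<bar>f x\<bar> powr p\<close>. Multiplying the eigenvalue equation by
  \<open>f\<close> and summing over the vertices shows that an eigenfunction has excess \<open>0\<close> with respect to its
  eigenvalue (\<open>excess_eigenfunction\<close>). The theorem follows from three further facts.

  The top variational eigenvalue is the maximum of the Rayleigh quotient, that is, the excess with
  respect to it is never positive (\<open>excess_top_eigenvalue\<close>). Indeed the unit sphere itself is the
  only set over which the infimum is taken (\<open>genus_family_top\<close>). A smaller symmetric set misses two
  points \<open>v\<close> and \<open>- v\<close>, and projecting along \<open>v\<close> maps it oddly into a hyperplane without meeting the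
  origin, so its genus is less than \<open>n\<close>. The genus of the whole sphere is at least \<open>n\<close> by the
  Borsuk-Ulam theorem. This is obtained from the fact that an odd self-map of a sphere has odd
  degree (\<open>odd_Brouwer_degree2_of_odd_map\<close>), whereas a map into a space of lower dimension has
  degree \<open>0\<close>.

  A maximizer has a strict sign (\<open>excess_maximizer_same_sign\<close>). Since \<open>\<sigma> = -1\<close>, an edge contributes
  \<open>w * \<bar>f x + f y\<bar> powr p\<close> to the energy. Passing to \<open>\<bar>f\<bar>\<close> increases this contribution when \<open>f\<close>
  has opposite signs at the two ends, so this never occurs, and \<open>\<bar>f\<bar>\<close> is a maximizer too. If \<open>\<bar>f\<bar>\<close>
  vanished at \<open>x\<close> but not at some neighbour, raising it to \<open>t\<close> at \<open>x\<close> would gain energy of order \<open>t\<close>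
  at a cost of order \<open>t powr p\<close>. By connectedness \<open>f\<close> has no zeros and keeps its sign.

  A positive eigenfunction \<open>f\<close> with eigenvalue \<open>ev\<close> makes the excess of every \<open>h\<close> with respect to
  \<open>ev\<close> nonpositive, and it is \<open>0\<close> only if \<open>h / f\<close> is constant along the edges
  (\<open>excess_positive_eigenfunction\<close>). This is a discrete form of Picone's inequality: on each edge,
  Jensen's inequality bounds \<open>\<bar>h x + h y\<bar> powr p\<close>, where \<open>h x + h y\<close> is read as the sum of
  \<open>h x / f x\<close> and \<open>h y / f y\<close> with weights \<open>f x\<close> and \<open>f y\<close>, and summing the bounds reproduces the
  eigenvalue equation of \<open>f\<close>. Hence \<open>ev\<close> is the maximum of the Rayleigh quotient, which is the third
  claim, and any other eigenfunction for the maximum is proportional to \<open>f\<close>, which is the second.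
\<close>

section \<open>Normalized maps of spheres and their degree\<close>

definition unitize :: "nat \<Rightarrow> (nat \<Rightarrow> real) \<Rightarrow> nat \<Rightarrow> real"
  where "unitize k u = (\<lambda>i. u i / sqrt (\<Sum>j\<le>k. (u j)\<^sup>2))"

lemma topspace_nsphere:
  "topspace (nsphere k) = {x. (\<Sum>i\<le>k. (x i)\<^sup>2) = 1 \<and> (\<forall>i>k. x i = 0)}"
  by (simp add: nsphere)

lemma nsphere_eq_top_of_set: "nsphere k = top_of_set (topspace (nsphere k))"
  by (simp add: nsphere euclidean_product_topology)

lemma continuous_map_nsphere_iff:
  "continuous_map (nsphere k) (nsphere l) f \<longleftrightarrow>
     continuous_on (topspace (nsphere k)) f \<and> f \<in> topspace (nsphere k) \<rightarrow> topspace (nsphere l)"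
proof -
  have "continuous_map (nsphere k) (nsphere l) f \<longleftrightarrow>
      continuous_map (top_of_set (topspace (nsphere k))) (top_of_set (topspace (nsphere l))) f"
    by (simp flip: nsphere_eq_top_of_set)
  then show ?thesis by (simp only: continuous_map_in_subtopology) auto
qed

lemma sum_squares_pos:
  assumes "u \<in> topspace (Euclidean_space (Suc k))" "u \<noteq> (\<lambda>i. 0)"
  shows "(\<Sum>j\<le>k. (u j)\<^sup>2) > 0"
proof -
  obtain i where i: "u i \<noteq> 0" using assms(2) by auto
  then have "i \<le> k" using assms(1) by (force simp: topspace_Euclidean_space not_less_eq_eq)
  then have "(u i)\<^sup>2 \<le> (\<Sum>j\<le>k. (u j)\<^sup>2)" by (intro member_le_sum) auto
  moreover have "(u i)\<^sup>2 > 0" using i by simp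
  ultimately show ?thesis by linarith
qed

lemma unitize_in_nsphere:
  assumes "u \<in> topspace (Euclidean_space (Suc k))" "u \<noteq> (\<lambda>i. 0)"
  shows "unitize k u \<in> topspace (nsphere k)"
proof -
  have "(\<Sum>j\<le>k. (u j)\<^sup>2) > 0" by (rule sum_squares_pos[OF assms])
  then show ?thesis using assms(1)
    by (auto simp: topspace_nsphere unitize_def power_divide topspace_Euclidean_space
        simp flip: sum_divide_distrib)
qed

lemma unitize_nsphere: "u \<in> topspace (nsphere k) \<Longrightarrow> unitize k u = u"
  by (simp add: topspace_nsphere unitize_def)

lemma unitize_minus: "unitize k (\<lambda>i. - u i) = (\<lambda>i. - unitize k u i)"
  by (simp add: unitize_def)

lemma nsphere_subset_Euclidean_space:
  "topspace (nsphere k) \<subseteq> topspace (Euclidean_space (Suc k))"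
  by (auto simp: topspace_nsphere topspace_Euclidean_space)

lemma nsphere_equator_subset: "topspace (nsphere k) \<subseteq> topspace (nsphere (Suc k))"
  by (auto simp: topspace_nsphere)

lemma continuous_on_unitize:
  fixes g :: "'a::topological_space \<Rightarrow> nat \<Rightarrow> real"
  assumes "continuous_on S g" "\<And>x. x \<in> S \<Longrightarrow> g x \<in> topspace (Euclidean_space (Suc k))"
    "\<And>x. x \<in> S \<Longrightarrow> g x \<noteq> (\<lambda>i. 0)"
  shows "continuous_on S (\<lambda>x. unitize k (g x))"
proof -
  have g: "continuous_on S (\<lambda>x. g x i)" for i
    using assms(1) by (rule continuous_on_product_then_coordinatewise)
  have "(\<Sum>j\<le>k. (g x j)\<^sup>2) > 0" if "x \<in> S" for x
    using sum_squares_pos assms that by blast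
  then have "continuous_on S (\<lambda>x. unitize k (g x) i)" for i
    unfolding unitize_def by (intro continuous_intros g) (auto simp: less_le)
  then show ?thesis by (intro continuous_on_coordinatewise_then_product)
qed

text \<open>
  Normalizing the straight-line homotopy gives a homotopy between the normalized maps, as long as
  no segment meets the origin. All homotopies below are of this form.
\<close>

lemma Brouwer_degree2_unitize_segment:
  assumes f: "continuous_on (topspace (nsphere k)) f" "f \<in> topspace (nsphere k) \<rightarrow> topspace (Euclidean_space (Suc k))"
    and g: "continuous_on (topspace (nsphere k)) g" "g \<in> topspace (nsphere k) \<rightarrow> topspace (Euclidean_space (Suc k))"
    and segment: "\<And>x t. x \<in> topspace (nsphere k) \<Longrightarrow> 0 \<le> t \<Longrightarrow> t \<le> 1 \<Longrightarrow> (\<lambda>i. (1 - t) * f x i + t * g x i) \<noteq> (\<lambda>i. 0)"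
  shows "Brouwer_degree2 k (unitize k \<circ> f) = Brouwer_degree2 k (unitize k \<circ> g)"
proof (rule Brouwer_degree2_homotopic)
  let ?S = "topspace (nsphere k)"
  define H where "H = (\<lambda>z. (\<lambda>i. (1 - fst z) * f (snd z) i + fst z * g (snd z) i))"
  have fi: "continuous_on ({0..1} \<times> ?S) (\<lambda>z. f (snd z) i)" 
   and gi: "continuous_on ({0..1} \<times> ?S) (\<lambda>z. g (snd z) i)" for i
    by (rule continuous_on_compose2[OF continuous_on_product_then_coordinatewise[OF f(1)]]
        continuous_on_compose2[OF continuous_on_product_then_coordinatewise[OF g(1)]]
        continuous_on_snd continuous_on_id, auto)+
  have "continuous_on ({0..1} \<times> ?S) H"
    unfolding H_def by (intro continuous_on_coordinatewise_then_product continuous_intros fi gi)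
  moreover have HE: "H z \<in> topspace (Euclidean_space (Suc k))" "H z \<noteq> (\<lambda>i. 0)" if "z \<in> {0..1} \<times> ?S" for z
    using f(2) g(2) segment that by (fastforce simp: H_def topspace_Euclidean_space Pi_iff)+
  ultimately have "continuous_on ({0..1} \<times> ?S) (\<lambda>z. unitize k (H z))"
    by (intro continuous_on_unitize) auto
  moreover have "(\<lambda>z. unitize k (H z)) \<in> ({0..1} \<times> ?S) \<rightarrow> ?S"
    using HE by (auto intro!: unitize_in_nsphere)
  ultimately have "homotopic_with_canon (\<lambda>x. True) ?S ?S (unitize k \<circ> f) (unitize k \<circ> g)"
    unfolding homotopic_with_def
    by (intro exI[of _ "\<lambda>z. unitize k (H z)"])
       (auto simp: H_def)
  then show "homotopic_with (\<lambda>x. True) (nsphere k) (nsphere k) (unitize k \<circ> f) (unitize k \<circ> g)"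
    using nsphere_eq_top_of_set[of k] by simp
qed

text \<open>
  The degree is multiplicative and the identity has degree \<open>1\<close>, so the square of the degree is \<open>1\<close>.
\<close>

lemma odd_Brouwer_degree2_involution:
  assumes "continuous_map (nsphere k) (nsphere k) r" "\<And>x. x \<in> topspace (nsphere k) \<Longrightarrow> r (r x) = x"
  shows "odd (Brouwer_degree2 k r)"
proof -
  have "Brouwer_degree2 k r * Brouwer_degree2 k r = Brouwer_degree2 k (r \<circ> r)"
    by (simp add: Brouwer_degree2_compose assms)
  also have "\<dots> = Brouwer_degree2 k id"
    by (rule Brouwer_degree2_eq) (simp add: assms)
  finally show ?thesis by (metis Brouwer_degree2_id even_mult_iff odd_one)
qed

section \<open>Reflections in hyperplanes\<close>

text \<open>
  The reflection in the hyperplane orthogonal to \<open>u\<close>, within the first \<open>k + 1\<close> coordinates. For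
  \<open>u = 0\<close> the quotient is \<open>0\<close> and the map is the identity.
\<close>

definition hyperplane_reflection :: "nat \<Rightarrow> (nat \<Rightarrow> real) \<Rightarrow> (nat \<Rightarrow> real) \<Rightarrow> nat \<Rightarrow> real"
  where "hyperplane_reflection k u x = (\<lambda>i. x i - 2 * (\<Sum>j\<le>k. x j * u j) / (\<Sum>j\<le>k. (u j)\<^sup>2) * u i)"

lemma hyperplane_reflection_involution: "hyperplane_reflection k u (hyperplane_reflection k u x) = x"
proof -
  define D where "D = (\<Sum>j\<le>k. (u j)\<^sup>2)"
  define c where "c = (\<Sum>j\<le>k. x j * u j)"
  have "(\<Sum>j\<le>k. (x j - 2 * c / D * u j) * u j) = c - 2 * c / D * D"
  proof -
    have "(\<Sum>j\<le>k. (x j - b * u j) * u j) = c - b * D" for b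
      unfolding c_def D_def
      by (simp add: algebra_simps sum_subtractf sum_distrib_left power2_eq_square)
    then show ?thesis .
  qed
  moreover have "D = 0 \<Longrightarrow> c = 0"
    unfolding c_def D_def by (simp add: sum_nonneg_eq_0_iff)
  ultimately have "(\<Sum>j\<le>k. (x j - 2 * c / D * u j) * u j) = - c"
    by (cases "D = 0") (auto simp: field_simps)
  then show ?thesis
    by (simp add: hyperplane_reflection_def flip: c_def D_def)
qed

lemma hyperplane_reflection_linear:
  "hyperplane_reflection k u (\<lambda>i. a * x i + b * y i) =
    (\<lambda>i. a * hyperplane_reflection k u x i + b * hyperplane_reflection k u y i)"
  by (simp add: hyperplane_reflection_def fun_eq_iff algebra_simps sum.distrib sum_distrib_left add_divide_distrib)

lemma hyperplane_reflection_scale: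
  "hyperplane_reflection k u (\<lambda>i. c * x i) = (\<lambda>i. c * hyperplane_reflection k u x i)"
  using hyperplane_reflection_linear[of k u c x 0 x] by simp

lemma hyperplane_reflection_nonzero:
  assumes "x \<noteq> (\<lambda>i. 0)"
  shows "hyperplane_reflection k u x \<noteq> (\<lambda>i. 0)"
  using assms hyperplane_reflection_involution[of k u x] hyperplane_reflection_scale[of k u 0 x] 
  by auto

lemma hyperplane_reflection_nsphere:
  assumes "x \<in> topspace (nsphere k)" "u \<in> topspace (Euclidean_space (Suc k))"
  shows "hyperplane_reflection k u x \<in> topspace (nsphere k)"
proof -
  define D where "D = (\<Sum>j\<le>k. (u j)\<^sup>2)"
  define c where "c = (\<Sum>j\<le>k. x j * u j)"
  have "(\<Sum>j\<le>k. (x j - 2 * c / D * u j)\<^sup>2) = (\<Sum>j\<le>k. (x j)\<^sup>2) - 4 * c / D * c + (2 * c / D)\<^sup>2 * D"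
  proof -
    have "(\<Sum>j\<le>k. (x j - b * u j)\<^sup>2) = (\<Sum>j\<le>k. (x j)\<^sup>2) - 2 * b * c + b\<^sup>2 * D" for b
      unfolding c_def D_def
      by (simp add: power2_eq_square sum_subtractf sum.distrib sum_distrib_left algebra_simps)
    from this[of "2 * c / D"] show ?thesis by simp
  qed
  also have "\<dots> = (\<Sum>j\<le>k. (x j)\<^sup>2)"
    by (cases "D = 0") (auto simp: field_simps power2_eq_square)
  finally show ?thesis
    using assms unfolding topspace_nsphere topspace_Euclidean_space
    by (simp add: hyperplane_reflection_def flip: c_def D_def)
qed

lemma hyperplane_reflection_Euclidean_space:
  assumes "u \<in> topspace (Euclidean_space m)" "x \<in> topspace (Euclidean_space m)"
  shows "hyperplane_reflection k u x \<in> topspace (Euclidean_space m)"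
  using assms by (simp add: hyperplane_reflection_def topspace_Euclidean_space)

lemma hyperplane_reflection_swap:
  assumes "v \<in> topspace (nsphere k)" "e \<in> topspace (nsphere k)"
  shows "hyperplane_reflection k (\<lambda>i. v i - e i) v = e"
proof -
  define D where "D = (\<Sum>j\<le>k. (v j - e j)\<^sup>2)"
  define c where "c = (\<Sum>j\<le>k. v j * (v j - e j))"
  have "D = (\<Sum>j\<le>k. (v j)\<^sup>2) + (\<Sum>j\<le>k. (e j)\<^sup>2) - 2 * (\<Sum>j\<le>k. v j * e j)"
    unfolding D_def by (simp add: power2_diff sum_subtractf sum.distrib sum_distrib_left algebra_simps)
  moreover have "c = (\<Sum>j\<le>k. (v j)\<^sup>2) - (\<Sum>j\<le>k. v j * e j)"
    unfolding c_def by (simp add: algebra_simps sum_subtractf power2_eq_square)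
  ultimately have D2: "D = 2 * c" using assms by (simp add: topspace_nsphere)
  show ?thesis
  proof (cases "D = 0")
    case True
    then have "\<forall>j\<le>k. v j = e j" unfolding D_def by (simp add: sum_nonneg_eq_0_iff)
    moreover have "\<forall>j>k. v j = e j" using assms by (simp add: topspace_nsphere)
    ultimately have "v = e" by (meson ext not_le)
    then show ?thesis by (simp add: hyperplane_reflection_def)
  next
    case False
    then have "2 * c / D = 1" using D2 by simp
    then show ?thesis by (simp add: hyperplane_reflection_def flip: c_def D_def)
  qed
qed

lemma continuous_on_hyperplane_reflection:
  fixes g :: "'a::topological_space \<Rightarrow> nat \<Rightarrow> real"
  assumes "continuous_on S g"
  shows "continuous_on S (\<lambda>x. hyperplane_reflection k u (g x))"
proof -
  have g: "continuous_on S (\<lambda>x. g x i)" for i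
    using assms(1) by (rule continuous_on_product_then_coordinatewise)
  show ?thesis unfolding hyperplane_reflection_def
    by (cases "(\<Sum>j\<le>k. (u j)\<^sup>2) = 0") 
      (auto intro!: continuous_on_coordinatewise_then_product continuous_intros g)
qed

section \<open>Approximation of odd maps by maps that miss a line\<close>

text \<open>
  An injective \<open>e\<close> numbers the coordinates of the vectors. The degree is defined for spheres of
  sequences, whereas polynomial approximation and the null sets of differentiable images
  live in Euclidean types. The two translations below connect them.
\<close>

definition seq_to_vec :: "('v::finite \<Rightarrow> nat) \<Rightarrow> (nat \<Rightarrow> real) \<Rightarrow> real ^ 'v"
  where "seq_to_vec e x = (\<chi> i. x (e i))"

definition vec_to_seq :: "('v::finite \<Rightarrow> nat) \<Rightarrow> real ^ 'v \<Rightarrow> nat \<Rightarrow> real"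
  where "vec_to_seq e y = (\<lambda>j. if j \<in> range e then y $ (inv_into UNIV e j) else 0)"

lemma seq_to_vec_vec_to_seq: "inj e \<Longrightarrow> seq_to_vec e (vec_to_seq e y) = y"
  by (simp add: seq_to_vec_def vec_to_seq_def vec_eq_iff)

lemma vec_to_seq_seq_to_vec:
  assumes "\<And>j. j \<notin> range e \<Longrightarrow> x j = 0"
  shows "vec_to_seq e (seq_to_vec e x) = x"
  using assms by (auto simp: seq_to_vec_def vec_to_seq_def f_inv_into_f)

lemma vec_to_seq_scaleR: "vec_to_seq e (c *\<^sub>R y) = (\<lambda>j. c * vec_to_seq e y j)"
  and vec_to_seq_minus: "vec_to_seq e (- y) = (\<lambda>j. - vec_to_seq e y j)"
  and seq_to_vec_minus: "seq_to_vec e (\<lambda>j. - x j) = - seq_to_vec e x"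
  by (auto simp: vec_to_seq_def seq_to_vec_def vec_eq_iff)

lemma continuous_on_vec_to_seq:
  fixes g :: "'a::topological_space \<Rightarrow> real ^ 'v::finite"
  assumes "continuous_on S g"
  shows "continuous_on S (\<lambda>x. vec_to_seq e (g x))"
  by (rule continuous_on_coordinatewise_then_product, unfold vec_to_seq_def, case_tac "i \<in> range e")
     (auto intro!: continuous_intros assms)

lemma continuous_on_seq_to_vec:
  fixes g :: "'a::topological_space \<Rightarrow> nat \<Rightarrow> real"
  assumes "continuous_on S g"
  shows "continuous_on S (\<lambda>x. seq_to_vec e (g x))"
  unfolding seq_to_vec_def
  using assms by (intro continuous_on_vec_lambda) (rule continuous_on_product_then_coordinatewise)

lemma norm_seq_to_vec:
  assumes "inj e" "range e = {..<n}" "Suc m \<le> n" "x \<in> topspace (Euclidean_space (Suc m))"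
  shows "(norm (seq_to_vec e x))\<^sup>2 = (\<Sum>j\<le>m. (x j)\<^sup>2)"
proof -
  have "(norm (seq_to_vec e x))\<^sup>2 = (\<Sum>i\<in>UNIV. (x (e i))\<^sup>2)"
    by (simp add: norm_vec_def L2_set_def seq_to_vec_def sum_nonneg)
  also have "\<dots> = (\<Sum>j\<in>range e. (x j)\<^sup>2)" by (simp add: sum.reindex assms(1))
  also have "\<dots> = (\<Sum>j\<le>m. (x j)\<^sup>2)"
    using assms by (intro sum.mono_neutral_right) (auto simp: topspace_Euclidean_space)
  finally show ?thesis .
qed

lemma ex_enumeration: "\<exists>e :: 'v::finite \<Rightarrow> nat. inj e \<and> range e = {..<CARD('v)}"
  using ex_bij_betw_finite_nat[of "UNIV::'v set"] by (auto simp: bij_betw_def atLeast0LessThan)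

lemma dim_coordinate_subspace:
  "dim {y :: real ^ 'v::finite. \<forall>i. i \<notin> d \<longrightarrow> y $ i = 0} = card d"
  using dim_substandard_cart[of d, where ?'a = real] by (simp add: dim_vec_eq)

text \<open>
  A continuous map may send the equator onto the whole sphere. A polynomial map cannot, because
  the image of the equator has too small a dimension. An odd polynomial approximation \<open>g\<close> of \<open>f\<close>
  therefore misses a whole line on the equator, and it is close enough to \<open>f\<close> that the segments
  between the two avoid the origin. The type \<open>'v\<close> only has to provide enough coordinates for the
  approximation to take place in \<open>real ^ 'v\<close>.
\<close>

lemma odd_approximation_missing_line:
  fixes f :: "(nat \<Rightarrow> real) \<Rightarrow> nat \<Rightarrow> real"
  assumes cont: "continuous_on (topspace (nsphere (Suc k))) f"
    and maps: "f \<in> topspace (nsphere (Suc k)) \<rightarrow> topspace (nsphere (Suc k))"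
    and odd: "\<And>x. x \<in> topspace (nsphere (Suc k)) \<Longrightarrow> f (\<lambda>i. - x i) = (\<lambda>i. - f x i)"
    and card: "Suc k < CARD('v::finite)"
  obtains g v where "continuous_on (topspace (nsphere (Suc k))) g"
    "g \<in> topspace (nsphere (Suc k)) \<rightarrow> topspace (Euclidean_space (Suc (Suc k)))"
    "\<And>x. x \<in> topspace (nsphere (Suc k)) \<Longrightarrow> g (\<lambda>i. - x i) = (\<lambda>i. - g x i)"
    "\<And>x t. \<lbrakk>x \<in> topspace (nsphere (Suc k)); 0 \<le> t; t \<le> 1\<rbrakk>
        \<Longrightarrow> (\<lambda>i. (1 - t) * f x i + t * g x i) \<noteq> (\<lambda>i. 0)"
    "v \<in> topspace (nsphere (Suc k))"
    "\<And>x c. x \<in> topspace (nsphere k) \<Longrightarrow> g x \<noteq> (\<lambda>i. c * v i)"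
proof -
  obtain e :: "'v \<Rightarrow> nat" where e: "inj e" "range e = {..<CARD('v)}"
    using ex_enumeration by blast
  \<comment> \<open>\<open>V m\<close> is a copy of \<open>\<real>\<^sup>m\<^sup>+\<^sup>1\<close>, so its unit sphere is a copy of the \<open>m\<close>-sphere.\<close>
  define V where "V = (\<lambda>m. {y :: real ^ 'v. \<forall>i. i \<notin> e -` {..m} \<longrightarrow> y $ i = 0})"
  have subV: "subspace (V m)" for m
    by (auto simp: V_def subspace_def)
  have dimV: "dim (V m) = Suc m" if "m < CARD('v)" for m
  proof -
    have "card (e -` {..m}) = card {..m}"
      using that e by (intro card_vimage_inj) auto
    then show ?thesis unfolding V_def by (subst dim_coordinate_subspace) simp
  qed
  have V_mono: "V k \<subseteq> V (Suc k)" by (auto simp: V_def)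
  have to_vec: "seq_to_vec e x \<in> sphere 0 1 \<inter> V m" if "x \<in> topspace (nsphere m)" "m < CARD('v)" for x m
  proof -
    have "(norm (seq_to_vec e x))\<^sup>2 = 1"
      using that norm_seq_to_vec[OF e, of m x] nsphere_subset_Euclidean_space[of m]
      by (auto simp: topspace_nsphere)
    then have "norm (seq_to_vec e x) = 1" by (metis norm_ge_zero one_power2 power2_eq_imp_eq zero_le_one)
    then show ?thesis using that
      by (auto simp: V_def seq_to_vec_def topspace_nsphere)
  qed
  have to_seq_E: "vec_to_seq e y \<in> topspace (Euclidean_space (Suc m))" if "y \<in> V m" "m < CARD('v)" for y m
    using that e(1) by (auto simp: topspace_Euclidean_space vec_to_seq_def V_def)
  have to_seq: "vec_to_seq e y \<in> topspace (nsphere m)" if "y \<in> sphere 0 1 \<inter> V m" "m < CARD('v)" for y m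
    using norm_seq_to_vec[OF e, of m "vec_to_seq e y"] to_seq_E[of y m] that
    by (auto simp: topspace_nsphere topspace_Euclidean_space seq_to_vec_vec_to_seq[OF e(1)])
  have inverse: "vec_to_seq e (seq_to_vec e x) = x" if "x \<in> topspace (nsphere (Suc k))" for x
    using that card e(2) by (intro vec_to_seq_seq_to_vec) (auto simp: topspace_nsphere)
  let ?T = "sphere 0 1 \<inter> V (Suc k)"
  define F where "F = (\<lambda>y. seq_to_vec e (f (vec_to_seq e y)))"
  have F_sphere: "F y \<in> ?T" if "y \<in> ?T" for y
    unfolding F_def using that maps card by (intro to_vec) (auto intro!: to_seq)
  have F_odd: "F (- y) = - F y" if "y \<in> ?T" for y
    using odd[OF to_seq[OF that card]] by (simp add: F_def vec_to_seq_minus seq_to_vec_minus)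
  have F_cont: "continuous_on ?T F"
    unfolding F_def
    by (rule continuous_on_seq_to_vec, rule continuous_on_compose2[OF cont],
        rule continuous_on_vec_to_seq, rule continuous_on_id) (use to_seq card in blast)
  have "compact ?T" by (intro compact_Int_closed compact_sphere closed_subspace subV)
  then obtain P where P: "polynomial_function P" "P ` ?T \<subseteq> V (Suc k)"
      "\<And>y. y \<in> ?T \<Longrightarrow> norm (F y - P y) < 1"
    using F_cont F_sphere subV
    by (elim Stone_Weierstrass_polynomial_function_subspace[of ?T F 1 "V (Suc k)"]) auto
  have minus_T: "- y \<in> ?T" if "y \<in> ?T" for y
    using that subspace_neg[OF subV] by auto
  \<comment> \<open>Taking the odd part of the approximation does not increase its distance from an odd map.\<close>
  define G where "G = (\<lambda>y. (1/2) *\<^sub>R (P y - P (- y)))"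
  have polyG: "polynomial_function G"
    unfolding G_def
    using polynomial_function_compose[OF polynomial_function_minus[OF polynomial_function_id] P(1)]
    by (intro polynomial_function_cmul polynomial_function_diff P) (simp add: o_def)
  have G_odd: "G (- y) = - G y" for y
    by (simp add: G_def algebra_simps)
  have G_V: "G y \<in> V (Suc k)" if "y \<in> ?T" for y
    unfolding G_def using P(2) that minus_T[OF that]
    by (intro subspace_scale subspace_diff subV) auto
  have close: "norm (F y - G y) < 1" if y: "y \<in> ?T" for y
  proof -
    have "F y - G y = (1/2) *\<^sub>R (F y - P y) - (1/2) *\<^sub>R (F (- y) - P (- y))"
      by (simp add: vec_eq_iff G_def F_odd[OF y] field_simps)
    also have "norm \<dots> \<le> norm ((1/2) *\<^sub>R (F y - P y)) + norm ((1/2) *\<^sub>R (F (- y) - P (- y)))"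
      by (rule norm_triangle_ineq4)
    also have "\<dots> < 1"
      using P(3)[OF y] P(3)[OF minus_T[OF y]] by simp
    finally show ?thesis .
  qed
  have segment: "(1 - t) *\<^sub>R F y + t *\<^sub>R G y \<noteq> 0" if y: "y \<in> ?T" and t: "0 \<le> t" "t \<le> 1" for y t
  proof
    assume "(1 - t) *\<^sub>R F y + t *\<^sub>R G y = 0"
    then have "F y = t *\<^sub>R (F y - G y)" by (simp add: algebra_simps)
    then have "norm (F y) = t * norm (F y - G y)" using t by (metis abs_of_nonneg norm_scaleR)
    also have "\<dots> \<le> 1 * norm (F y - G y)" using t by (intro mult_right_mono) auto
    finally show False using close[OF y] F_sphere[OF y] by simp
  qed
  have G_nz: "G y \<noteq> 0" if "y \<in> ?T" for y
    using segment[OF that, of 1] by simp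
  \<comment> \<open>A smooth map from the unit sphere of \<open>V k\<close> cannot fill the unit sphere of \<open>V (Suc k)\<close>, which
    has one dimension more. A point outside the image of the normalized \<open>G\<close> gives the line.\<close>
  define N where "N = (\<lambda>y. G y /\<^sub>R norm (G y))"
  have "N differentiable_on sphere 0 1 \<inter> V k"
  proof -
    have "G differentiable_on sphere 0 1 \<inter> V k"
      by (rule differentiable_on_polynomial_function[OF polyG])
    moreover have "(\<lambda>y. norm (G y)) differentiable_on sphere 0 1 \<inter> V k"
      using G_nz V_mono
      by (intro differentiable_on_compose[of G _ norm] calculation) 
         (auto intro!: differentiable_on_norm)
    ultimately show ?thesis
      unfolding N_def using G_nz V_mono
      by (intro differentiable_on_scaleR differentiable_on_inverse) auto
  qed
  then have "N ` (sphere 0 1 \<inter> V k) \<noteq> ?T"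
    using dimV card V_mono by (intro spheremap_lemma1 subV) auto
  moreover have "N ` (sphere 0 1 \<inter> V k) \<subseteq> ?T"
    using G_nz G_V V_mono by (auto simp: N_def intro!: subspace_scale[OF subV])
  ultimately obtain v where v: "v \<in> ?T" "v \<notin> N ` (sphere 0 1 \<inter> V k)" by blast
  show ?thesis
  proof
    show "continuous_on (topspace (nsphere (Suc k))) (\<lambda>x. vec_to_seq e (G (seq_to_vec e x)))"
      by (intro continuous_on_vec_to_seq continuous_on_compose2[OF continuous_on_polymonial_function[OF polyG, of UNIV]]
          continuous_on_seq_to_vec continuous_intros) auto
    show "(\<lambda>x. vec_to_seq e (G (seq_to_vec e x))) \<in> topspace (nsphere (Suc k)) \<rightarrow> topspace (Euclidean_space (Suc (Suc k)))"
      using to_vec card by (auto intro!: to_seq_E G_V)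
    show "vec_to_seq e (G (seq_to_vec e (\<lambda>i. - x i))) = (\<lambda>i. - vec_to_seq e (G (seq_to_vec e x)) i)" for x
      by (simp add: seq_to_vec_minus G_odd vec_to_seq_minus)
    show "(\<lambda>i. (1 - t) * f x i + t * vec_to_seq e (G (seq_to_vec e x)) i) \<noteq> (\<lambda>i. 0)"
      if x: "x \<in> topspace (nsphere (Suc k))" and t: "0 \<le> t" "t \<le> 1" for x t
    proof
      assume eq: "(\<lambda>i. (1 - t) * f x i + t * vec_to_seq e (G (seq_to_vec e x)) i) = (\<lambda>i. 0)"
      have "(1 - t) *\<^sub>R F (seq_to_vec e x) + t *\<^sub>R G (seq_to_vec e x) = 0"
      proof (rule vec_eq_iff[THEN iffD2], intro allI)
        fix i
        have "F (seq_to_vec e x) = seq_to_vec e (f x)" by (simp add: F_def inverse[OF x])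
        then show "((1 - t) *\<^sub>R F (seq_to_vec e x) + t *\<^sub>R G (seq_to_vec e x)) $ i = 0 $ i"
          using fun_cong[OF eq, of "e i"] e(1)
          by (simp add: seq_to_vec_def[of e "f x"] vec_to_seq_def)
      qed
      then show False using segment[OF to_vec[OF x card] t] by simp
    qed
    show "vec_to_seq e v \<in> topspace (nsphere (Suc k))"
      using to_seq[OF v(1) card] .
    show "vec_to_seq e (G (seq_to_vec e x)) \<noteq> (\<lambda>i. c * vec_to_seq e v i)"
      if x: "x \<in> topspace (nsphere k)" for x c
    proof
      define y where "y = seq_to_vec e x"
      have y: "y \<in> sphere 0 1 \<inter> V k" unfolding y_def using to_vec[OF x] card by simp
      then have yT: "y \<in> ?T" using V_mono by auto
      assume "vec_to_seq e (G (seq_to_vec e x)) = (\<lambda>i. c * vec_to_seq e v i)"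
      then have "vec_to_seq e (G y) = vec_to_seq e (c *\<^sub>R v)"
        by (simp add: y_def vec_to_seq_scaleR)
      then have Gy: "G y = c *\<^sub>R v"
        using seq_to_vec_vec_to_seq[OF e(1)] by metis
      have "norm v = 1" using v(1) by simp
      then have N: "N y = (c / \<bar>c\<bar>) *\<^sub>R v" and c: "c \<noteq> 0"
        using G_nz[OF yT] by (auto simp: N_def Gy divide_inverse)
      have N_minus: "N (- y) = - N y" by (simp add: N_def G_odd)
      have y_minus: "- y \<in> sphere 0 1 \<inter> V k" using y subspace_neg[OF subV] by auto
      have "v \<in> N ` (sphere 0 1 \<inter> V k)"
      proof (cases "c > 0")
        case True
        then have "v = N y" using N by simp
        then show ?thesis using y by (rule image_eqI)
      next
        case False
        then have "v = N (- y)" using N N_minus c by simp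
        then show ?thesis using y_minus by (rule image_eqI)
      qed
      then show False using v(2) by blast
    qed
  qed
qed

section \<open>Odd maps of spheres have odd degree\<close>

text \<open>
  Borsuk's theorem, by induction on the dimension. Modulo \<open>2\<close>, the degree of an odd map that preserves
  the equator equals the degree of its restriction to the equator
  (\<open>Borsuk_odd_mapping_degree_step\<close>). Hence it suffices to deform a given odd map, up to a
  reflection, into one that preserves the equator. This is possible once the equator avoids the
  poles.
\<close>

theorem odd_Brouwer_degree2_of_odd_map:
  assumes "continuous_on (topspace (nsphere k)) f"
    and "f \<in> topspace (nsphere k) \<rightarrow> topspace (nsphere k)"
    and "\<And>x. x \<in> topspace (nsphere k) \<Longrightarrow> f (\<lambda>i. - x i) = (\<lambda>i. - f x i)"
    and "k < CARD('v::finite)"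
  shows "odd (Brouwer_degree2 k f)"
  using assms
proof (induction k arbitrary: f)
  case 0
  \<comment> \<open>The \<open>0\<close>-sphere has two points, so an odd self-map is an involution.\<close>
  have two_points: "x = (\<lambda>i. if i = 0 then 1 else 0) \<or> x = (\<lambda>i. if i = 0 then -1 else 0)"
    if "x \<in> topspace (nsphere 0)" for x
    using that by (auto simp: topspace_nsphere power2_eq_1_iff fun_eq_iff)
  have involution: "f (f x) = x" if x: "x \<in> topspace (nsphere 0)" for x
  proof -
    have *: "(\<lambda>i::nat. - (if i = 0 then c else 0)) = (\<lambda>i. if i = 0 then - c else 0)" for c :: real
      by auto
    have "f x = x \<or> f x = (\<lambda>i. - x i)"
      using two_points[OF x] two_points[OF funcset_mem[OF 0(2) x]] by (auto simp: *)
    then show ?thesis using 0(3)[OF x] by auto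
  qed
  show ?case
    by (rule odd_Brouwer_degree2_involution) (use 0 involution in \<open>auto simp: continuous_map_nsphere_iff\<close>)
next
  case (Suc k)
  let ?S = "topspace (nsphere (Suc k))"
  obtain g v where g: "continuous_on ?S g" "g \<in> ?S \<rightarrow> topspace (Euclidean_space (Suc (Suc k)))"
      "\<And>x. x \<in> ?S \<Longrightarrow> g (\<lambda>i. - x i) = (\<lambda>i. - g x i)"
    and segment: "\<And>x t. \<lbrakk>x \<in> ?S; 0 \<le> t; t \<le> 1\<rbrakk>
        \<Longrightarrow> (\<lambda>i. (1 - t) * f x i + t * g x i) \<noteq> (\<lambda>i. 0)"
    and v: "v \<in> ?S" and missing: "\<And>x c. x \<in> topspace (nsphere k) \<Longrightarrow> g x \<noteq> (\<lambda>i. c * v i)"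
    using odd_approximation_missing_line[OF Suc.prems] by blast
  define pole :: "nat \<Rightarrow> real" where "pole = (\<lambda>i. if i = Suc k then 1 else 0)"
  have pole: "pole \<in> ?S" 
    by (simp add: pole_def topspace_nsphere power2_eq_square if_distrib[where f = "\<lambda>x. x * _"] cong: if_cong)
  \<comment> \<open>The reflection \<open>r\<close> moves the line missed by \<open>g\<close> to the polar axis.\<close>
  define u where "u = (\<lambda>i. v i - pole i)"
  have u: "u \<in> topspace (Euclidean_space (Suc (Suc k)))"
    using v pole by (auto simp: u_def topspace_Euclidean_space topspace_nsphere)
  define r where "r = hyperplane_reflection (Suc k) u"
  have r_cont: "continuous_map (nsphere (Suc k)) (nsphere (Suc k)) r"
    unfolding continuous_map_nsphere_iff r_def
    using continuous_on_hyperplane_reflection[OF continuous_on_id]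
    by (auto intro!: hyperplane_reflection_nsphere u)
  have r_v: "r v = pole" unfolding r_def u_def by (rule hyperplane_reflection_swap[OF v pole])
  have rr: "r (r x) = x" for x by (simp add: r_def hyperplane_reflection_involution)
  define q where "q = r \<circ> g"
  have q: "continuous_on ?S q" "q \<in> ?S \<rightarrow> topspace (Euclidean_space (Suc (Suc k)))"
    using g u by (auto simp: q_def r_def o_def intro!: continuous_on_hyperplane_reflection
        hyperplane_reflection_Euclidean_space)
  have q_odd: "q (\<lambda>i. - x i) = (\<lambda>i. - q x i)" if "x \<in> ?S" for x
    using g(3)[OF that] hyperplane_reflection_scale[of "Suc k" u "-1" "g x"] by (simp add: q_def r_def)
  have q_missing: "q x \<noteq> (\<lambda>i. c * pole i)" if x: "x \<in> topspace (nsphere k)" for x c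
  proof
    assume "q x = (\<lambda>i. c * pole i)"
    then have "g x = r (\<lambda>i. c * r v i)"
      by (metis comp_def q_def r_v rr)
    then show False
      using missing[OF x] by (metis hyperplane_reflection_scale r_def rr)
  qed
  \<comment> \<open>Shrinking the polar coordinate by the factor \<open>\<bar>x\<^sub>k\<^sub>+\<^sub>1\<bar>\<close> keeps the map odd and presses the image
    of the equator into the equatorial plane. A zero could appear only on the equator, at a point
    that \<open>q\<close> maps to the polar axis, and there is no such point.\<close>
  define h where "h = (\<lambda>x i. if i = Suc k then \<bar>x i\<bar> * q x i else q x i)"
  have q_i: "continuous_on ?S (\<lambda>x. q x i)" for i
    using q(1) by (rule continuous_on_product_then_coordinatewise)
  have x_i: "continuous_on ?S (\<lambda>x. x i)" for i
    by (rule continuous_on_product_then_coordinatewise) (rule continuous_on_id)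
  have h_cont: "continuous_on ?S h" unfolding h_def
    by (rule continuous_on_coordinatewise_then_product, case_tac "i = Suc k")
      (auto intro!: continuous_intros q_i x_i)
  have h_maps: "h \<in> ?S \<rightarrow> topspace (Euclidean_space (Suc (Suc k)))"
    using q(2) by (auto simp: h_def topspace_Euclidean_space Pi_iff)
  have q_nz: "q x \<noteq> (\<lambda>i. 0)" if "x \<in> ?S" for x
    using segment[OF that, of 1] hyperplane_reflection_nonzero[of "g x"] by (simp add: q_def r_def)
  have h_segment: "(\<lambda>i. (1 - t) * q x i + t * h x i) \<noteq> (\<lambda>i. 0)"
    if x: "x \<in> ?S" and t: "0 \<le> t" "t \<le> 1" for x t
  proof
    assume eq: "(\<lambda>i. (1 - t) * q x i + t * h x i) = (\<lambda>i. 0)"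
    have low: "q x i = 0" if "i \<noteq> Suc k" for i
      using fun_cong[OF eq, of i] that by (simp add: h_def algebra_simps)
    then have q_pole: "q x = (\<lambda>i. q x (Suc k) * pole i)" by (auto simp: pole_def)
    have "q x (Suc k) \<noteq> 0" using q_nz[OF x] low by (metis ext)
    moreover have "q x (Suc k) * ((1 - t) + t * \<bar>x (Suc k)\<bar>) = 0"
      using fun_cong[OF eq, of "Suc k"] by (simp add: h_def algebra_simps)
    ultimately have "(1 - t) + t * \<bar>x (Suc k)\<bar> = 0" by simp
    moreover have "t * \<bar>x (Suc k)\<bar> \<ge> 0" using t by simp
    ultimately have "t = 1" "t * \<bar>x (Suc k)\<bar> = 0" using t by linarith+
    then have "x (Suc k) = 0" by simp
    then have "x \<in> topspace (nsphere k)" using topspace_nsphere_minus1[OF x] by simp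
    then show False using q_missing q_pole by blast
  qed
  have h_nz: "h x \<noteq> (\<lambda>i. 0)" if "x \<in> ?S" for x
    using h_segment[OF that, of 1] by simp
  define F where "F = (\<lambda>x. unitize (Suc k) (h x))"
  have F_cont: "continuous_on ?S F" unfolding F_def
    using h_cont h_maps h_nz by (intro continuous_on_unitize) auto
  have F_maps: "F \<in> ?S \<rightarrow> ?S" unfolding F_def
    using h_maps h_nz by (auto intro!: unitize_in_nsphere)
  have F_odd: "F (\<lambda>i. - x i) = (\<lambda>i. - F x i)" if "x \<in> ?S" for x
  proof -
    have "h (\<lambda>i. - x i) = (\<lambda>i. - h x i)" by (auto simp: h_def q_odd[OF that])
    then show ?thesis by (simp add: F_def unitize_minus)
  qed
  have F_equator: "F \<in> topspace (nsphere k) \<rightarrow> topspace (nsphere k)"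
  proof
    fix x assume x: "x \<in> topspace (nsphere k)"
    then have "F x \<in> ?S" using F_maps nsphere_equator_subset by auto
    moreover have "F x (Suc k) = 0" using x by (simp add: F_def unitize_def h_def topspace_nsphere)
    ultimately show "F x \<in> topspace (nsphere k)" using topspace_nsphere_minus1 by fastforce
  qed
  have "Brouwer_degree2 (Suc k) r * Brouwer_degree2 (Suc k) f = Brouwer_degree2 (Suc k) (r \<circ> f)"
    by (rule Brouwer_degree2_compose[OF _ r_cont, symmetric])
      (use Suc.prems in \<open>simp add: continuous_map_nsphere_iff\<close>)
  also have "\<dots> = Brouwer_degree2 (Suc k) (unitize (Suc k) \<circ> (r \<circ> f))"
    using Suc.prems(2) u
    by (intro Brouwer_degree2_eq) (auto simp: r_def intro!: unitize_nsphere[symmetric] hyperplane_reflection_nsphere)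
  also have "\<dots> = Brouwer_degree2 (Suc k) (unitize (Suc k) \<circ> q)"
  proof (rule Brouwer_degree2_unitize_segment[OF _ _ q])
    show "continuous_on ?S (r \<circ> f)"
      using Suc.prems(1) by (auto simp: r_def o_def intro!: continuous_on_hyperplane_reflection)
    show "r \<circ> f \<in> ?S \<rightarrow> topspace (Euclidean_space (Suc (Suc k)))"
      using Suc.prems(2) u nsphere_subset_Euclidean_space[of "Suc k"]
      by (auto simp: r_def intro!: hyperplane_reflection_Euclidean_space)
    show "(\<lambda>i. (1 - t) * (r \<circ> f) x i + t * q x i) \<noteq> (\<lambda>i. 0)" if "x \<in> ?S" "0 \<le> t" "t \<le> 1" for x t
      using hyperplane_reflection_nonzero[OF segment[OF that]]
      by (simp add: r_def q_def hyperplane_reflection_linear)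
  qed
  also have "\<dots> = Brouwer_degree2 (Suc k) (unitize (Suc k) \<circ> h)"
    by (rule Brouwer_degree2_unitize_segment[OF q h_cont h_maps h_segment])
  also have "unitize (Suc k) \<circ> h = F" by (simp add: F_def o_def)
  finally have deg: "Brouwer_degree2 (Suc k) r * Brouwer_degree2 (Suc k) f = Brouwer_degree2 (Suc k) F" .
  have "odd (Brouwer_degree2 k F)"
  proof (rule Suc.IH)
    show "continuous_on (topspace (nsphere k)) F"
      by (rule continuous_on_subset[OF F_cont nsphere_equator_subset])
    show "F (\<lambda>i. - x i) = (\<lambda>i. - F x i)" if "x \<in> topspace (nsphere k)" for x
      using F_odd that nsphere_equator_subset by blast
  qed (use F_equator Suc.prems(4) in auto)
  moreover have "even (Brouwer_degree2 (Suc k) F - Brouwer_degree2 (Suc k - Suc 0) F)"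
    by (rule Borsuk_odd_mapping_degree_step)
      (use F_cont F_maps F_odd F_equator in \<open>auto simp: continuous_map_nsphere_iff\<close>)
  ultimately have "odd (Brouwer_degree2 (Suc k) F)" by simp
  then show ?case using deg by (metis even_mult_iff)
qed

text \<open>
  Without a zero, \<open>f\<close> could be normalized to an odd self-map of the sphere. Its image lies in the
  equator, so that its degree would be \<open>0\<close>, which is even.
\<close>

theorem Borsuk_Ulam_nsphere:
  assumes "continuous_on (topspace (nsphere k)) f"
    and "f \<in> topspace (nsphere k) \<rightarrow> topspace (Euclidean_space k)"
    and "\<And>x. x \<in> topspace (nsphere k) \<Longrightarrow> f (\<lambda>i. - x i) = (\<lambda>i. - f x i)"
    and "k < CARD('v::finite)"
  shows "\<exists>x\<in>topspace (nsphere k). f x = (\<lambda>i. 0)"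
proof (rule ccontr)
  assume "\<not> ?thesis"
  then have nz: "f x \<noteq> (\<lambda>i. 0)" if "x \<in> topspace (nsphere k)" for x using that by blast
  have E: "f x \<in> topspace (Euclidean_space (Suc k))" if "x \<in> topspace (nsphere k)" for x
    using assms(2) that by (auto simp: topspace_Euclidean_space Pi_iff)
  define F where "F = (\<lambda>x. unitize k (f x))"
  have F: "continuous_on (topspace (nsphere k)) F" "F \<in> topspace (nsphere k) \<rightarrow> topspace (nsphere k)"
    unfolding F_def using E nz by (auto intro!: continuous_on_unitize assms(1) unitize_in_nsphere)
  have "odd (Brouwer_degree2 k F)"
    by (rule odd_Brouwer_degree2_of_odd_map[OF F]) (use assms in \<open>simp_all add: F_def unitize_minus\<close>)
  moreover have "Brouwer_degree2 k F = 0"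
  proof (rule Brouwer_degree2_nonsurjective)
    define pole :: "nat \<Rightarrow> real" where "pole = (\<lambda>i. if i = k then 1 else 0)"
    have "pole \<in> topspace (nsphere k)" 
    by (simp add: pole_def topspace_nsphere power2_eq_square if_distrib[where f = "\<lambda>x. x * _"] cong: if_cong)
    moreover have "F x k = 0" if "x \<in> topspace (nsphere k)" for x
      using assms(2) that by (auto simp: F_def unitize_def topspace_Euclidean_space Pi_iff)
    moreover have "pole k = 1" by (simp add: pole_def)
    ultimately show "F ` topspace (nsphere k) \<noteq> topspace (nsphere k)"
      by (metis image_iff zero_neq_one)
  qed (use F in \<open>simp add: continuous_map_nsphere_iff\<close>)
  ultimately show False by simp
qed

section \<open>The genus of the unit sphere and of its subsets\<close>

definition power_sum :: "real \<Rightarrow> ('v::finite \<Rightarrow> real) \<Rightarrow> real ^ 'v \<Rightarrow> real"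
  where "power_sum p c f = (\<Sum>x\<in>UNIV. c x * \<bar>f $ x\<bar> powr p)"

lemma power_sum_scaleR: "power_sum p c (a *\<^sub>R f) = \<bar>a\<bar> powr p * power_sum p c f"
  by (simp add: power_sum_def abs_mult powr_mult sum_distrib_left mult_ac)

lemma continuous_on_power_sum [continuous_intros]:
  assumes "p > 0" "continuous_on S g"
  shows "continuous_on S (\<lambda>x. power_sum p c (g x))"
  unfolding power_sum_def using assms by (auto intro!: continuous_intros continuous_on_powr')

lemma power_sum_pos:
  assumes "\<And>x. \<mu> x > 0" "f \<noteq> 0"
  shows "power_sum p \<mu> f > 0"
proof -
  obtain x where x: "f $ x \<noteq> 0" using assms(2) by (auto simp: vec_eq_iff)
  show ?thesis unfolding power_sum_def
    using x assms(1) by (intro sum_pos2[of _ x]) (auto simp: less_imp_le)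
qed

lemma unit_p_sphere_iff: "f \<in> unit_p_sphere p \<mu> \<longleftrightarrow> power_sum p \<mu> f = 1"
  by (simp add: unit_p_sphere_def power_sum_def)

lemma nonzero_on_unit_p_sphere: "f \<in> unit_p_sphere p \<mu> \<Longrightarrow> f \<noteq> 0"
  by (auto simp: unit_p_sphere_def)

lemma uminus_unit_p_sphere: "uminus ` unit_p_sphere p \<mu> = unit_p_sphere p \<mu>"
  by (force simp: unit_p_sphere_def image_iff intro: exI[of _ "- _"])

lemma normalized_in_unit_p_sphere:
  assumes "p > 0" "\<And>x. \<mu> x > 0" "f \<noteq> 0"
  shows "(power_sum p \<mu> f powr (- 1 / p)) *\<^sub>R f \<in> unit_p_sphere p \<mu>"
proof -
  have pos: "power_sum p \<mu> f > 0" by (rule power_sum_pos[of \<mu>, OF assms(2,3)])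
  have "(power_sum p \<mu> f powr (- 1 / p)) powr p = power_sum p \<mu> f powr (- 1)"
    using assms(1) by (subst powr_powr) simp
  then show ?thesis using pos
    by (simp add: unit_p_sphere_iff power_sum_scaleR powr_neg_one)
qed

lemma compact_unit_p_sphere:
  assumes "p > 0" and \<mu>: "\<And>x. \<mu> x > 0"
  shows "compact (unit_p_sphere p \<mu>)"
proof -
  have "closed (unit_p_sphere p \<mu>)"
    unfolding unit_p_sphere_iff[abs_def] 
    using continuous_closed_preimage_constant[of UNIV "power_sum p \<mu>" 1] continuous_on_power_sum[OF assms(1) continuous_on_id, of UNIV \<mu>]
    by (simp add: unit_p_sphere_def power_sum_def)
  moreover have "bounded (unit_p_sphere p \<mu>)"
  proof -
    have "norm f \<le> (\<Sum>x\<in>UNIV. (1 / \<mu> x) powr (1 / p))" if f: "f \<in> unit_p_sphere p \<mu>" for f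
    proof -
      have "\<bar>f $ x\<bar> \<le> (1 / \<mu> x) powr (1 / p)" for x
      proof -
        have "\<mu> x * \<bar>f $ x\<bar> powr p \<le> (\<Sum>x\<in>UNIV. \<mu> x * \<bar>f $ x\<bar> powr p)"
          using \<mu> by (intro member_le_sum) (auto simp: less_imp_le)
        then have "\<bar>f $ x\<bar> powr p \<le> 1 / \<mu> x"
          using f \<mu>[of x] by (simp add: unit_p_sphere_def field_simps)
        then have "(\<bar>f $ x\<bar> powr p) powr (1 / p) \<le> (1 / \<mu> x) powr (1 / p)"
          using assms(1) by (intro powr_mono2) auto
        then show ?thesis using assms(1) by (simp add: powr_powr)
      qed
      then have "(\<Sum>x\<in>UNIV. \<bar>f $ x\<bar>) \<le> (\<Sum>x\<in>UNIV. (1 / \<mu> x) powr (1 / p))"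
        by (intro sum_mono)
      then show ?thesis using norm_le_l1_cart[of f] by linarith
    qed
    then show ?thesis by (auto simp: bounded_iff)
  qed
  ultimately show ?thesis by (simp add: compact_eq_bounded_closed)
qed

lemma genus_unit_p_sphere:
  fixes \<mu> :: "'v::finite \<Rightarrow> real"
  assumes "p > 0" and \<mu>: "\<And>x. \<mu> x > 0"
  shows "genus (unit_p_sphere p \<mu>) \<ge> enat CARD('v)"
proof -
  let ?S = "unit_p_sphere p \<mu>"
  \<comment> \<open>Composed with the radial projection \<open>N\<close>, an odd map from the sphere into a punctured space of
    small dimension becomes one that contradicts the Borsuk-Ulam theorem.\<close>
  have no_map: "CARD('v) \<le> k" if "odd_map_into_punctured k ?S h" for k h
  proof (rule ccontr)
    assume "\<not> CARD('v) \<le> k"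
    then obtain m where m: "k \<le> m" "CARD('v) = Suc m"
      by (metis Suc_pred leD less_Suc_eq_le not_le zero_less_card_finite)
    have h: "continuous_on ?S h" "h \<in> ?S \<rightarrow> topspace (Euclidean_space k)"
      and h_nz: "\<And>f. f \<in> ?S \<Longrightarrow> h f \<noteq> (\<lambda>i. 0)"
      and h_odd: "\<And>f i. f \<in> ?S \<Longrightarrow> h (- f) i = - h f i"
      using that by (auto simp: odd_map_into_punctured_def Euclidean_space_def euclidean_product_topology
          continuous_map_in_subtopology)
    obtain e :: "'v \<Rightarrow> nat" where e: "inj e" "range e = {..<CARD('v)}"
      using ex_enumeration by blast
    define y where "y = seq_to_vec e"
    define N where "N = (\<lambda>f :: real ^ 'v. (power_sum p \<mu> f powr (- 1 / p)) *\<^sub>R f)"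
    have y_nz: "y x \<noteq> 0" if "x \<in> topspace (nsphere m)" for x
      using norm_seq_to_vec[OF e, of m x] that nsphere_subset_Euclidean_space[of m] m
      by (auto simp: y_def topspace_nsphere)
    have N: "N f \<in> ?S" if "f \<noteq> 0" for f
      unfolding N_def by (rule normalized_in_unit_p_sphere[OF assms that])
    have y_cont: "continuous_on (topspace (nsphere m)) y"
      unfolding y_def by (rule continuous_on_seq_to_vec[OF continuous_on_id])
    have "power_sum p \<mu> (y x) \<noteq> 0" if "x \<in> topspace (nsphere m)" for x
      using power_sum_pos[of \<mu>, OF \<mu> y_nz[OF that], of p] by simp
    then have N_cont: "continuous_on (topspace (nsphere m)) (\<lambda>x. N (y x))"
      unfolding N_def
      by (intro continuous_intros y_cont assms(1)) auto
    have N_minus: "N (- f) = - N f" for f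
      by (simp add: N_def power_sum_def)
    have "\<exists>x\<in>topspace (nsphere m). h (N (y x)) = (\<lambda>i. 0)"
    proof (rule Borsuk_Ulam_nsphere[where ?'v = 'v])
      show "continuous_on (topspace (nsphere m)) (\<lambda>x. h (N (y x)))"
        using N y_nz by (intro continuous_on_compose2[OF h(1) N_cont]) auto
      show "(\<lambda>x. h (N (y x))) \<in> topspace (nsphere m) \<rightarrow> topspace (Euclidean_space m)"
        using h(2) N y_nz m(1) subset_Euclidean_space[of k m] by fast
      show "h (N (y (\<lambda>i. - x i))) = (\<lambda>i. - h (N (y x)) i)" if "x \<in> topspace (nsphere m)" for x
        using h_odd[OF N[OF y_nz[OF that]]] by (auto simp: y_def seq_to_vec_minus N_minus)
    qed (use m in simp)
    then show False using h_nz N y_nz by blast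
  qed
  have "?S \<noteq> {}"
    using normalized_in_unit_p_sphere[OF assms, of 1] by fastforce
  then show ?thesis
    by (auto simp: genus_def le_Inf_iff dest: no_map)
qed

text \<open>
  A symmetric set that omits a point \<open>v\<close> of the sphere also omits \<open>- v\<close>, hence meets the line
  through \<open>v\<close> nowhere. The projection along this line is then an odd map into a space of one
  dimension less that has no zero on the set.
\<close>

lemma genus_less_of_proper_subset:
  fixes \<mu> :: "'v::finite \<Rightarrow> real"
  assumes "p > 0" and A: "uminus ` A = A" "A \<subset> unit_p_sphere p \<mu>"
  shows "genus A < enat CARD('v)"
proof (cases "A = {}")
  case True
  then show ?thesis by (simp add: genus_def zero_enat_def)
next
  case False
  obtain v where v: "v \<in> unit_p_sphere p \<mu>" "v \<notin> A" using A(2) by blast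
  then obtain i0 where i0: "v $ i0 \<noteq> 0"
    using nonzero_on_unit_p_sphere by (metis vec_eq_iff zero_index)
  define m where "m = CARD('v) - 1"
  have "card (UNIV - {i0} :: 'v set) = m" by (simp add: m_def)
  then obtain b where b: "bij_betw b {..<m} (UNIV - {i0})"
    using ex_bij_betw_nat_finite[of "UNIV - {i0} :: 'v set"] by (auto simp: atLeast0LessThan)
  \<comment> \<open>\<open>h\<close> is the projection along \<open>v\<close> onto the hyperplane where the coordinate \<open>i0\<close> vanishes.\<close>
  define h where "h = (\<lambda>f :: real ^ 'v. \<lambda>j. if j < m then f $ b j - f $ i0 / v $ i0 * v $ b j else 0)"
  have h_nz: "h f \<noteq> (\<lambda>i. 0)" if f: "f \<in> A" for f
  proof
    assume 0: "h f = (\<lambda>i. 0)"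
    define c where "c = f $ i0 / v $ i0"
    have "f $ i = c * v $ i" for i
    proof (cases "i = i0")
      case True
      then show ?thesis using i0 by (simp add: c_def)
    next
      case False
      then obtain j where "j < m" "i = b j" using b by (auto simp: bij_betw_def)
      then show ?thesis using fun_cong[OF 0, of j] by (simp add: h_def c_def)
    qed
    then have fv: "f = c *\<^sub>R v" by (simp add: vec_eq_iff)
    have "f \<in> unit_p_sphere p \<mu>" using f A(2) by blast
    then have "\<bar>c\<bar> powr p = 1" using v(1) by (simp add: unit_p_sphere_iff fv power_sum_scaleR)
    then have "\<bar>c\<bar> = 1" using assms(1) by (metis abs_ge_zero powr_eq_one_iff_gen abs_0 less_eq_real_def less_irrefl powr_0 zero_neq_one)
    then have "f = v \<or> f = - v" using fv by (auto simp: abs_if split: if_splits)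
    then show False using f v(2) A(1) by (metis image_eqI minus_minus)
  qed
  have "continuous_map (top_of_set A) (Euclidean_space m) h"
    unfolding h_def continuous_map_componentwise_Euclidean_space
    by (auto intro!: continuous_intros simp: i0)
  then have h: "odd_map_into_punctured m A h"
    using h_nz by (auto simp: odd_map_into_punctured_def) (simp add: h_def)
  have "m > 0"
  proof (rule ccontr)
    assume "\<not> m > 0"
    then have "h f = (\<lambda>i. 0)" for f by (simp add: h_def)
    then show False using h_nz False by blast
  qed
  then have "genus A \<le> enat m"
    using h False by (auto simp: genus_def intro!: Inf_lower)
  also have "enat m < enat CARD('v)" by (simp add: m_def)
  finally show ?thesis .
qed

lemma genus_family_top:
  fixes \<mu> :: "'v::finite \<Rightarrow> real"
  assumes "p > 0" and "\<And>x. \<mu> x > 0"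
  shows "genus_family p \<mu> CARD('v) = {unit_p_sphere p \<mu>}"
proof -
  have "A = unit_p_sphere p \<mu>" if "A \<in> genus_family p \<mu> CARD('v)" for A
    using genus_less_of_proper_subset[OF assms(1), of A \<mu>] that
    by (auto simp: genus_family_def not_less[symmetric] psubset_eq)
  moreover have "unit_p_sphere p \<mu> \<in> genus_family p \<mu> CARD('v)"
    using compact_unit_p_sphere[of p \<mu>] genus_unit_p_sphere[of p \<mu>] assms
    by (simp add: genus_family_def uminus_unit_p_sphere)
  ultimately show ?thesis by blast
qed

section \<open>Strict convexity of the power function\<close>

lemma \<Phi>_mult_self: "\<Phi> p t * t = \<bar>t\<bar> powr p"
proof (cases "t = 0")
  case False
  have "\<Phi> p t * t = \<bar>t\<bar> powr (p - 2) * \<bar>t\<bar> powr 2"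
    using False by (simp add: \<Phi>_def power2_eq_square)
  also have "\<dots> = \<bar>t\<bar> powr p" using False powr_add[of "\<bar>t\<bar>" "p - 2" 2] by simp
  finally show ?thesis .
qed (simp add: \<Phi>_def)

lemma \<Phi>_pos: "t > 0 \<Longrightarrow> \<Phi> p t = t powr (p - 1)"
  using \<Phi>_mult_self[of p t] by (simp add: powr_diff field_simps)

lemma \<Phi>_minus: "\<Phi> p (- t) = - \<Phi> p t"
  by (simp add: \<Phi>_def)

lemma \<Phi>_zero [simp]: "\<Phi> p 0 = 0"
  by (simp add: \<Phi>_def)

lemma \<Phi>_nonneg: "t \<ge> 0 \<Longrightarrow> \<Phi> p t \<ge> 0"
  by (simp add: \<Phi>_def)

lemma \<Phi>_eq_0_iff: "\<Phi> p t = 0 \<longleftrightarrow> t = 0"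
  by (simp add: \<Phi>_def)

lemma Bernoulli_powr_strict:
  fixes r p :: real
  assumes "p > 1" "r > 0" "r \<noteq> 1"
  shows "r powr p > 1 + p * (r - 1)"
proof (cases "r > 1")
  case True
  have "\<exists>z. 1 < z \<and> z < r \<and> r powr p - 1 powr p = (r - 1) * (p * z powr (p - 1))"
    using True by (intro MVT2) (auto intro!: derivative_eq_intros)
  then obtain z where z: "1 < z" "r powr p - 1 = (r - 1) * (p * z powr (p - 1))" by auto
  have "z powr (p - 1) > 1" using z(1) assms(1) by simp
  then have "(r - 1) * (p * z powr (p - 1)) > (r - 1) * (p * 1)"
    using True assms(1) by (intro mult_strict_left_mono) auto
  then show ?thesis using z(2) by (simp add: algebra_simps)
next
  case False
  then have r: "r < 1" using assms by simp
  have "\<exists>z. r < z \<and> z < 1 \<and> 1 powr p - r powr p = (1 - r) * (p * z powr (p - 1))"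
    using r assms(2) by (intro MVT2) (auto intro!: derivative_eq_intros)
  then obtain z where z: "r < z" "z < 1" "1 - r powr p = (1 - r) * (p * z powr (p - 1))" by auto
  have "z powr (p - 1) < 1" using z assms powr_less_mono2[of "p - 1" z 1] by simp
  then have "(1 - r) * (p * z powr (p - 1)) < (1 - r) * (p * 1)"
    using r assms(1) by (intro mult_strict_left_mono) auto
  then show ?thesis using z(3) by (simp add: algebra_simps)
qed

text \<open>
  The derivative of \<open>\<lambda>z. \<bar>z\<bar> powr p\<close> is \<open>p * \<Phi> p z\<close>. Scaling reduces a
  tangent point \<open>z \<noteq> 0\<close> to \<open>1\<close>, where the claim is Bernoulli's inequality for positive arguments,
  while at the others the tangent lies below the axis.
\<close>

lemma abs_powr_above_tangent_strict:
  fixes s z p :: real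
  assumes p: "p > 1" and "s \<noteq> z"
  shows "\<bar>s\<bar> powr p > \<bar>z\<bar> powr p + p * \<Phi> p z * (s - z)"
proof (cases "z = 0")
  case True
  then show ?thesis using assms by simp
next
  case z: False
  define r where "r = s / z"
  have s: "s = r * z" and "r \<noteq> 1" using z assms(2) by (auto simp: r_def)
  have "\<bar>r\<bar> powr p > 1 + p * (r - 1)"
  proof (cases "r > 0")
    case True
    then show ?thesis using Bernoulli_powr_strict[OF p True \<open>r \<noteq> 1\<close>] by simp
  next
    case False
    then have "1 + p * (r - 1) < 0 + p * r" using p by (simp add: algebra_simps)
    also have "\<dots> \<le> 0" using p False by (simp add: mult_nonneg_nonpos)
    finally show ?thesis by (smt (verit) powr_ge_zero)
  qed
  then have "\<bar>z\<bar> powr p * (1 + p * (r - 1)) < \<bar>z\<bar> powr p * \<bar>r\<bar> powr p"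
    using z by (intro mult_strict_left_mono) auto
  also have "\<dots> = \<bar>s\<bar> powr p" by (simp add: s abs_mult powr_mult mult.commute)
  finally have less: "\<bar>z\<bar> powr p + p * (\<bar>z\<bar> powr p * (r - 1)) < \<bar>s\<bar> powr p"
    by (simp add: algebra_simps)
  have "\<bar>z\<bar> powr p * (r - 1) = \<Phi> p z * (s - z)"
    by (simp add: s algebra_simps flip: \<Phi>_mult_self)
  then show ?thesis using less by (simp only: mult.assoc)
qed

lemma abs_powr_above_tangent:
  fixes s z p :: real
  assumes "p > 1"
  shows "\<bar>s\<bar> powr p \<ge> \<bar>z\<bar> powr p + p * \<Phi> p z * (s - z)"
  using abs_powr_above_tangent_strict[OF assms, of s z] by (cases "s = z") auto

text \<open>
  Jensen's inequality for the weights \<open>a\<close> and \<open>b\<close>, cleared of denominators. The factor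
  \<open>\<Phi> p (a + b)\<close> is the one in which the edge terms of the Laplacian of a positive function appear.
\<close>

lemma abs_powr_Jensen:
  fixes a b s t p :: real
  assumes p: "p > 1" and ab: "a > 0" "b > 0"
  defines "R \<equiv> \<Phi> p (a + b) * (a * \<bar>s\<bar> powr p + b * \<bar>t\<bar> powr p)"
  shows "\<bar>a * s + b * t\<bar> powr p \<le> R"
    and "\<bar>a * s + b * t\<bar> powr p = R \<Longrightarrow> s = t"
proof -
  define m where "m = (a * s + b * t) / (a + b)"
  have m: "(a + b) * m = a * s + b * t" using ab by (simp add: m_def)
  have balance: "a * (s - m) + b * (t - m) = 0" using m by (simp add: algebra_simps)
  have low: "\<bar>a * s + b * t\<bar> powr p = \<Phi> p (a + b) * (a + b) * \<bar>m\<bar> powr p"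
    using ab by (simp add: \<Phi>_mult_self abs_mult powr_mult flip: m)
  \<comment> \<open>\<open>d\<close> is the height of \<open>\<lambda>s. \<bar>s\<bar> powr p\<close> above its tangent at the weighted mean \<open>m\<close>. The linear
    terms cancel in the weighted sum.\<close>
  define d where "d = (\<lambda>s. \<bar>s\<bar> powr p - (\<bar>m\<bar> powr p + p * \<Phi> p m * (s - m)))"
  have "a * d s + b * d t = a * \<bar>s\<bar> powr p + b * \<bar>t\<bar> powr p - (a + b) * \<bar>m\<bar> powr p
      - p * \<Phi> p m * (a * (s - m) + b * (t - m))"
    by (simp add: d_def algebra_simps)
  then have "a * d s + b * d t = a * \<bar>s\<bar> powr p + b * \<bar>t\<bar> powr p - (a + b) * \<bar>m\<bar> powr p"
    by (simp only: balance mult_zero_right diff_zero)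
  then have gap: "R - \<bar>a * s + b * t\<bar> powr p = \<Phi> p (a + b) * (a * d s + b * d t)"
    unfolding R_def low by (simp only: right_diff_distrib mult.assoc)
  have d: "d s \<ge> 0" "d t \<ge> 0"
    using abs_powr_above_tangent[OF p] by (simp_all add: d_def)
  have \<Phi>: "\<Phi> p (a + b) > 0" using ab \<Phi>_pos[of "a + b" p] by simp
  show "\<bar>a * s + b * t\<bar> powr p \<le> R" using gap d \<Phi> ab
    by (smt (verit) mult_nonneg_nonneg)
  show "s = t" if "\<bar>a * s + b * t\<bar> powr p = R"
  proof -
    have "a * d s + b * d t = 0" using gap that \<Phi> by simp
    moreover have "a * d s \<ge> 0" "b * d t \<ge> 0" using d ab by auto
    ultimately have "a * d s = 0" "b * d t = 0" by linarith+
    then have "d s = 0" "d t = 0" using ab by auto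
    then have "s = m" "t = m"
      using abs_powr_above_tangent_strict[OF p, of s m] abs_powr_above_tangent_strict[OF p, of t m]
      by (auto simp: d_def)
    then show ?thesis by simp
  qed
qed

section \<open>The energy and the eigenvalue equation\<close>

text \<open>
  The contribution of the edges to the energy for the signature \<open>-1\<close>.
\<close>

definition edge_energy :: "real \<Rightarrow> 'v::finite set set \<Rightarrow> ('v set \<Rightarrow> real) \<Rightarrow> real ^ 'v \<Rightarrow> real"
  where "edge_energy p E w f =
    (1/2) * (\<Sum>x\<in>UNIV. \<Sum>y | {x, y} \<in> E. w {x, y} * \<bar>f $ x + f $ y\<bar> powr p)"

text \<open>
  Up to the positive factor \<open>power_sum p \<mu> f\<close>, this is the difference between the Rayleigh quotient
  of \<open>f\<close> and \<open>ev\<close>. Being free of the denominator, it also makes sense for \<open>f = 0\<close>.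
\<close>

definition excess :: "real \<Rightarrow> 'v::finite set set \<Rightarrow> ('v set \<Rightarrow> real) \<Rightarrow> ('v \<Rightarrow> real) \<Rightarrow> ('v \<Rightarrow> real)
    \<Rightarrow> real \<Rightarrow> real ^ 'v \<Rightarrow> real"
  where "excess p E w \<mu> \<kappa> ev f = edge_energy p E w f + power_sum p \<kappa> f - ev * power_sum p \<mu> f"

lemma edge_energy_scaleR: "edge_energy p E w (a *\<^sub>R f) = \<bar>a\<bar> powr p * edge_energy p E w f"
proof -
  have "\<bar>(a *\<^sub>R f) $ x + (a *\<^sub>R f) $ y\<bar> powr p = \<bar>a\<bar> powr p * \<bar>f $ x + f $ y\<bar> powr p" for x y
    by (simp add: abs_mult powr_mult flip: distrib_left)
  then show ?thesis by (simp add: edge_energy_def sum_distrib_left mult_ac)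
qed

lemma excess_scaleR: "excess p E w \<mu> \<kappa> ev (a *\<^sub>R f) = \<bar>a\<bar> powr p * excess p E w \<mu> \<kappa> ev f"
  by (simp add: excess_def power_sum_scaleR edge_energy_scaleR algebra_simps)

lemma continuous_on_edge_energy:
  assumes "p > 0"
  shows "continuous_on S (edge_energy p E w)"
  unfolding edge_energy_def using assms by (auto intro!: continuous_intros continuous_on_powr')

lemma sum_edges_swap:
  fixes a :: "'v::finite \<Rightarrow> 'v \<Rightarrow> real"
  shows "(\<Sum>x\<in>UNIV. \<Sum>y | {x, y} \<in> E. a x y) = (\<Sum>x\<in>UNIV. \<Sum>y | {x, y} \<in> E. a y x)"
  using sum.swap_restrict[of UNIV UNIV a "\<lambda>x y. {x, y} \<in> E"] by (simp add: insert_commute)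

text \<open>
  Summation by parts on the graph: a symmetric edge function paired with \<open>c x + c y\<close> becomes a sum
  over the vertices.
\<close>

lemma sum_edges_symmetrize:
  fixes b :: "'v::finite \<Rightarrow> 'v \<Rightarrow> real" and c :: "'v \<Rightarrow> real"
  assumes "\<And>x y. b x y = b y x"
  shows "(1/2) * (\<Sum>x\<in>UNIV. \<Sum>y | {x, y} \<in> E. b x y * (c x + c y))
    = (\<Sum>x\<in>UNIV. c x * (\<Sum>y | {x, y} \<in> E. b x y))"
proof -
  have "(\<Sum>x\<in>UNIV. \<Sum>y | {x, y} \<in> E. b x y * c y) = (\<Sum>x\<in>UNIV. \<Sum>y | {x, y} \<in> E. b x y * c x)"
    using sum_edges_swap[of "\<lambda>x y. b x y * c y" E] assms by simp
  then show ?thesis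
    by (simp add: distrib_left sum.distrib sum_distrib_left mult.commute)
qed

lemma connected_graph_induct:
  assumes "connected_graph E" "P x0" "\<And>x y. {x, y} \<in> E \<Longrightarrow> P x \<Longrightarrow> P y"
  shows "P x"
proof -
  have "(\<lambda>u v. {u, v} \<in> E)\<^sup>*\<^sup>* x0 x" using assms(1) by (simp add: connected_graph_def)
  then show ?thesis by induction (use assms in auto)
qed

lemma eigenfunction_uminus:
  assumes "eigenfunction p E w \<mu> \<kappa> \<sigma> ev f"
  shows "eigenfunction p E w \<mu> \<kappa> \<sigma> ev (- f)"
proof -
  have "p_laplacian p E w \<kappa> \<sigma> (- f) x = - p_laplacian p E w \<kappa> \<sigma> f x" for x
  proof -
    have "\<Phi> p ((- f) $ x - \<sigma> {x, y} * (- f) $ y) = - \<Phi> p (f $ x - \<sigma> {x, y} * f $ y)" for y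
      by (simp flip: \<Phi>_minus)
    then show ?thesis by (simp add: p_laplacian_def \<Phi>_minus sum_negf)
  qed
  then show ?thesis using assms by (simp add: eigenfunction_def \<Phi>_minus)
qed

context
  fixes E :: "'v::finite set set" and w \<sigma> :: "'v set \<Rightarrow> real" and \<mu> \<kappa> :: "'v \<Rightarrow> real" and p :: real
  assumes p: "p > 1" and graph: "weighted_signed_graph E w \<mu> \<sigma>"
    and antibalanced: "\<forall>e\<in>E. \<sigma> e = -1"
begin

lemma edge_weight_pos: "e \<in> E \<Longrightarrow> w e > 0"
  using graph by (simp add: weighted_signed_graph_def)

lemma vertex_weight_pos: "\<mu> x > 0"
  using graph by (simp add: weighted_signed_graph_def)

lemma p_laplacian_antibalanced:
  "p_laplacian p E w \<kappa> \<sigma> f x =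
    (\<Sum>y | {x, y} \<in> E. w {x, y} * \<Phi> p (f $ x + f $ y)) + \<kappa> x * \<Phi> p (f $ x)"
  unfolding p_laplacian_def using antibalanced by (intro arg_cong2[of _ _ _ _ "(+)"] sum.cong) auto

lemma rayleigh_quotient_antibalanced:
  "rayleigh_quotient p E w \<mu> \<kappa> \<sigma> f = (edge_energy p E w f + power_sum p \<kappa> f) / power_sum p \<mu> f"
proof -
  have "(\<Sum>x\<in>UNIV. \<Sum>y | {x, y} \<in> E. w {x, y} * \<bar>f $ x - \<sigma> {x, y} * f $ y\<bar> powr p) =
    (\<Sum>x\<in>UNIV. \<Sum>y | {x, y} \<in> E. w {x, y} * \<bar>f $ x + f $ y\<bar> powr p)"
    using antibalanced by (intro sum.cong) auto
  then show ?thesis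
    by (simp add: rayleigh_quotient_def edge_energy_def power_sum_def)
qed

text \<open>
  The weak form of the eigenvalue equation, with test function \<open>c\<close>.
\<close>

lemma eigenfunction_tested:
  assumes "eigenfunction p E w \<mu> \<kappa> \<sigma> ev f"
  shows "(\<Sum>x\<in>UNIV. c x * (\<Sum>y | {x, y} \<in> E. w {x, y} * \<Phi> p (f $ x + f $ y)))
      + (\<Sum>x\<in>UNIV. \<kappa> x * (c x * \<Phi> p (f $ x))) = ev * (\<Sum>x\<in>UNIV. \<mu> x * (c x * \<Phi> p (f $ x)))"
proof -
  have eq: "c x * p_laplacian p E w \<kappa> \<sigma> f x = c x * (ev * \<mu> x * \<Phi> p (f $ x))" for x
    using assms by (simp add: eigenfunction_def)
  have "(\<Sum>x\<in>UNIV. c x * p_laplacian p E w \<kappa> \<sigma> f x) = (\<Sum>x\<in>UNIV. c x * (ev * \<mu> x * \<Phi> p (f $ x)))"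
    by (simp only: eq)
  then show ?thesis
    by (simp add: p_laplacian_antibalanced distrib_left sum.distrib sum_distrib_left mult_ac)
qed

text \<open>
  Test the equation with \<open>f\<close> itself.
\<close>

lemma excess_eigenfunction:
  assumes "eigenfunction p E w \<mu> \<kappa> \<sigma> ev f"
  shows "excess p E w \<mu> \<kappa> ev f = 0"
proof -
  have "edge_energy p E w f =
      (1/2) * (\<Sum>x\<in>UNIV. \<Sum>y | {x, y} \<in> E. w {x, y} * \<Phi> p (f $ x + f $ y) * (f $ x + f $ y))"
    unfolding edge_energy_def by (simp add: mult.assoc \<Phi>_mult_self)
  also have "\<dots> = (\<Sum>x\<in>UNIV. f $ x * (\<Sum>y | {x, y} \<in> E. w {x, y} * \<Phi> p (f $ x + f $ y)))"
    by (rule sum_edges_symmetrize) (simp add: insert_commute add.commute)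
  finally show ?thesis
    using eigenfunction_tested[OF assms, of "\<lambda>x. f $ x"]
    by (simp add: excess_def power_sum_def mult.commute[of "f $ _"] \<Phi>_mult_self)
qed

text \<open>
  Test the equation of \<open>f\<close> with \<open>c x = \<bar>h x\<bar> powr p / \<Phi> p (f x)\<close>. The terms with \<open>\<kappa>\<close> and \<open>\<mu>\<close> then
  agree with those of \<open>h\<close>, so the excess of \<open>h\<close> is minus the total loss in Jensen's inequality on
  the edges.
\<close>

lemma excess_positive_eigenfunction:
  assumes f: "eigenfunction p E w \<mu> \<kappa> \<sigma> ev f" and pos: "\<And>x. f $ x > 0"
  shows excess_nonpos: "excess p E w \<mu> \<kappa> ev h \<le> 0"
    and excess_eq_0D: "excess p E w \<mu> \<kappa> ev h = 0 \<Longrightarrow> {x, y} \<in> E \<Longrightarrow> h $ x / f $ x = h $ y / f $ y"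
proof -
  define q where "q = (\<lambda>x. h $ x / f $ x)"
  define c where "c = (\<lambda>x. f $ x * \<bar>q x\<bar> powr p)"
  have h: "h $ x = f $ x * q x" for x using pos[of x] by (simp add: q_def)
  have c\<Phi>: "c x * \<Phi> p (f $ x) = \<bar>h $ x\<bar> powr p" for x
  proof -
    have "c x * \<Phi> p (f $ x) = (\<Phi> p (f $ x) * f $ x) * \<bar>q x\<bar> powr p" by (simp add: c_def)
    then show ?thesis by (simp add: \<Phi>_mult_self h abs_mult powr_mult)
  qed
  \<comment> \<open>\<open>gap\<close> is the loss in Jensen's inequality for
    \<open>h x + h y = f x * q x + f y * q y\<close>.\<close>
  define gap where "gap = (\<lambda>x y. w {x, y} * (\<Phi> p (f $ x + f $ y) * (c x + c y) - \<bar>h $ x + h $ y\<bar> powr p))"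
  have gap_nonneg: "gap x y \<ge> 0" if "{x, y} \<in> E" for x y
    using abs_powr_Jensen(1)[OF p pos[of x] pos[of y], of "q x" "q y"] edge_weight_pos[OF that]
    by (simp add: gap_def h c_def)
  have "(1/2) * (\<Sum>x\<in>UNIV. \<Sum>y | {x, y} \<in> E. gap x y) =
     (1/2) * (\<Sum>x\<in>UNIV. \<Sum>y | {x, y} \<in> E. w {x, y} * \<Phi> p (f $ x + f $ y) * (c x + c y))
     - edge_energy p E w h"
    by (simp add: gap_def edge_energy_def right_diff_distrib sum_subtractf mult.assoc)
  also have "\<dots> = (\<Sum>x\<in>UNIV. c x * (\<Sum>y | {x, y} \<in> E. w {x, y} * \<Phi> p (f $ x + f $ y))) - edge_energy p E w h"
    by (subst sum_edges_symmetrize) (simp_all add: insert_commute add.commute)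
  also have "\<dots> = - excess p E w \<mu> \<kappa> ev h"
    using eigenfunction_tested[OF f, of c] by (simp add: c\<Phi> excess_def power_sum_def)
  finally have excess: "excess p E w \<mu> \<kappa> ev h = - (1/2) * (\<Sum>x\<in>UNIV. \<Sum>y | {x, y} \<in> E. gap x y)"
    by simp
  have inner: "(\<Sum>y | {x, y} \<in> E. gap x y) \<ge> 0" for x
    by (intro sum_nonneg) (use gap_nonneg in auto)
  then have "(\<Sum>x\<in>UNIV. \<Sum>y | {x, y} \<in> E. gap x y) \<ge> 0" by (rule sum_nonneg)
  then show "excess p E w \<mu> \<kappa> ev h \<le> 0" using excess by simp
  show "h $ x / f $ x = h $ y / f $ y" if zero: "excess p E w \<mu> \<kappa> ev h = 0" and xy: "{x, y} \<in> E"
  proof -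
    have "(\<Sum>x\<in>UNIV. \<Sum>y | {x, y} \<in> E. gap x y) = 0" using zero excess by simp
    then have "(\<Sum>y | {x, y} \<in> E. gap x y) = 0"
      using sum_nonneg_eq_0_iff[of UNIV "\<lambda>x. \<Sum>y | {x, y} \<in> E. gap x y"] inner by auto
    then have "gap x y = 0"
      using gap_nonneg xy by (subst (asm) sum_nonneg_eq_0_iff) auto
    then have "q x = q y"
      using abs_powr_Jensen(2)[OF p pos[of x] pos[of y], of "q x" "q y"] edge_weight_pos[OF xy]
      by (simp add: gap_def h c_def)
    then show ?thesis by (simp add: q_def)
  qed
qed

text \<open>
  The edge energy is convex. The linear term is its derivative at \<open>u\<close> in the direction \<open>v - u\<close>.
\<close>

lemma edge_energy_above_tangent:
  "edge_energy p E w v \<ge> edge_energy p E w u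
    + p * (\<Sum>x\<in>UNIV. (v $ x - u $ x) * (\<Sum>y | {x, y} \<in> E. w {x, y} * \<Phi> p (u $ x + u $ y)))"
proof -
  have "edge_energy p E w u + p * ((1/2) * (\<Sum>x\<in>UNIV. \<Sum>y | {x, y} \<in> E.
        w {x, y} * \<Phi> p (u $ x + u $ y) * ((v $ x - u $ x) + (v $ y - u $ y))))
    = (1/2) * (\<Sum>x\<in>UNIV. \<Sum>y | {x, y} \<in> E. w {x, y} * (\<bar>u $ x + u $ y\<bar> powr p
        + p * \<Phi> p (u $ x + u $ y) * ((v $ x + v $ y) - (u $ x + u $ y))))"
    unfolding edge_energy_def
    by (simp add: sum_distrib_left sum.distrib sum_subtractf algebra_simps)
  also have "\<dots> \<le> edge_energy p E w v"
    unfolding edge_energy_def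
    by (intro mult_left_mono sum_mono abs_powr_above_tangent[OF p])
       (auto intro: less_imp_le edge_weight_pos)
  finally show ?thesis
    by (subst (asm) sum_edges_symmetrize) (simp_all add: insert_commute add.commute)
qed

section \<open>Maximizers of the Rayleigh quotient\<close>

lemma excess_maximizer_same_sign:
  assumes conn: "connected_graph E"
    and max: "\<And>h. excess p E w \<mu> \<kappa> ev h \<le> 0" and f: "excess p E w \<mu> \<kappa> ev f = 0" and "f \<noteq> 0"
  shows "(\<forall>x. f $ x > 0) \<or> (\<forall>x. f $ x < 0)"
proof -
  define u where "u = (\<chi> x. \<bar>f $ x\<bar>)"
  have u: "u $ x = \<bar>f $ x\<bar>" for x by (simp add: u_def)
  have sums: "power_sum p c u = power_sum p c f" for c by (simp add: power_sum_def u)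
  \<comment> \<open>Replacing \<open>f\<close> by \<open>\<bar>f\<bar>\<close> gains \<open>gap\<close> on each edge. There is nothing left to gain.\<close>
  define gap where "gap = (\<lambda>x y. w {x, y} * (\<bar>u $ x + u $ y\<bar> powr p - \<bar>f $ x + f $ y\<bar> powr p))"
  have gap_nonneg: "gap x y \<ge> 0" if "{x, y} \<in> E" for x y
    unfolding gap_def using edge_weight_pos[OF that] p
    by (auto intro!: mult_nonneg_nonneg powr_mono2 simp: u)
  have inner: "(\<Sum>y | {x, y} \<in> E. gap x y) \<ge> 0" for x
    by (intro sum_nonneg) (use gap_nonneg in auto)
  have "excess p E w \<mu> \<kappa> ev u = excess p E w \<mu> \<kappa> ev f + (1/2) * (\<Sum>x\<in>UNIV. \<Sum>y | {x, y} \<in> E. gap x y)"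
    by (simp add: excess_def sums edge_energy_def gap_def right_diff_distrib sum_subtractf)
  moreover have "(\<Sum>x\<in>UNIV. \<Sum>y | {x, y} \<in> E. gap x y) \<ge> 0"
    by (rule sum_nonneg) (rule inner)
  ultimately have excess_u: "excess p E w \<mu> \<kappa> ev u = 0"
    and "(\<Sum>x\<in>UNIV. \<Sum>y | {x, y} \<in> E. gap x y) = 0"
    using max[of u] f by auto
  then have "(\<Sum>y | {x, y} \<in> E. gap x y) = 0" for x
    using sum_nonneg_eq_0_iff[of UNIV "\<lambda>x. \<Sum>y | {x, y} \<in> E. gap x y"] inner by auto
  then have gap_0: "gap x y = 0" if "{x, y} \<in> E" for x y
    using gap_nonneg that by (subst (asm) sum_nonneg_eq_0_iff) auto
  have no_opposite: "f $ x * f $ y \<ge> 0" if xy: "{x, y} \<in> E" for x y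
  proof (rule ccontr)
    assume "\<not> f $ x * f $ y \<ge> 0"
    then have "\<bar>f $ x + f $ y\<bar> < \<bar>u $ x + u $ y\<bar>" by (auto simp: u not_le mult_less_0_iff)
    then have "\<bar>f $ x + f $ y\<bar> powr p < \<bar>u $ x + u $ y\<bar> powr p" using p by (intro powr_less_mono2) auto
    then show False using gap_0[OF xy] edge_weight_pos[OF xy] by (simp add: gap_def)
  qed
  have zero_spreads: "f $ y = 0" if xy: "{x, y} \<in> E" and x: "f $ x = 0" for x y
  proof -
    \<comment> \<open>Raising the zero of \<open>u\<close> at \<open>x\<close> to a small \<open>t > 0\<close> gains at least \<open>t * p * A\<close> on the edges,
      while the potential and the norm contribute only the multiple \<open>c\<close> of \<open>t powr p\<close>.\<close>
    define A where "A = (\<Sum>y | {x, y} \<in> E. w {x, y} * \<Phi> p (u $ x + u $ y))"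
    define c where "c = \<kappa> x - ev * \<mu> x"
    have bound: "p * A \<le> - c * t powr (p - 1)" if t: "t > 0" for t
    proof -
      define v where "v = u + axis x t"
      have ux: "u $ x = 0" by (simp add: u x)
      have v: "v $ z = (if z = x then t else u $ z)" for z by (auto simp: v_def axis_def ux)
      have diff: "v $ z - u $ z = (if z = x then t else 0)" for z by (simp add: v ux)
      have ps: "power_sum p b v = power_sum p b u + b x * t powr p" for b
      proof -
        have "b z * \<bar>v $ z\<bar> powr p = b z * \<bar>u $ z\<bar> powr p + (if z = x then b x * t powr p else 0)" for z
          using t ux by (simp add: v)
        then show ?thesis by (simp add: power_sum_def sum.distrib)
      qed
      have "edge_energy p E w v \<ge> edge_energy p E w u + p * (t * A)"
        using edge_energy_above_tangent[of u v] by (simp add: diff A_def if_distrib[of "\<lambda>a. a * _"] cong: if_cong)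
      moreover have "excess p E w \<mu> \<kappa> ev v - excess p E w \<mu> \<kappa> ev u =
          edge_energy p E w v - edge_energy p E w u + c * t powr p"
        by (simp add: excess_def ps c_def algebra_simps)
      ultimately have "p * (t * A) + c * t powr p \<le> 0"
        using max[of v] excess_u by linarith
      moreover have "t powr p = t * t powr (p - 1)" using t by (simp add: powr_diff)
      ultimately have "t * (p * A + c * t powr (p - 1)) \<le> 0" by (simp add: algebra_simps)
      then have "p * A + c * t powr (p - 1) \<le> 0" using t by (simp add: mult_le_0_iff)
      then show ?thesis by simp
    qed
    have "((\<lambda>t::real. - c * t powr (p - 1)) \<longlongrightarrow> - c * 0 powr (p - 1)) (at_right 0)"
      using p by (intro tendsto_intros tendsto_powr') (auto simp: eventually_at_right_less less_imp_le eventually_at_right_field intro!: exI[of _ 1])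
    moreover have "\<forall>\<^sub>F t in at_right (0::real). p * A \<le> - c * t powr (p - 1)"
      using bound by (auto simp: eventually_at_right_field intro!: exI[of _ 1])
    ultimately have "p * A \<le> 0"
      using tendsto_lowerbound[of _ _ "at_right (0::real)"] p by fastforce
    then have "A \<le> 0" using p by (simp add: mult_le_0_iff)
    moreover have nonneg: "w {x, y} * \<Phi> p (u $ x + u $ y) \<ge> 0" if "{x, y} \<in> E" for y
      using edge_weight_pos[OF that] by (simp add: u \<Phi>_nonneg)
    ultimately have "A = 0" unfolding A_def by (intro antisym sum_nonneg) auto
    then have "w {x, y} * \<Phi> p (u $ x + u $ y) = 0"
      unfolding A_def using nonneg xy by (subst (asm) sum_nonneg_eq_0_iff) auto
    then show ?thesis using edge_weight_pos[OF xy] by (simp add: \<Phi>_eq_0_iff u x)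
  qed
  have nonzero: "f $ x \<noteq> 0" for x
  proof
    assume "f $ x = 0"
    then have "f $ y = 0" for y by (rule connected_graph_induct[OF conn, of "\<lambda>x. f $ x = 0"]) (rule zero_spreads)
    then show False using \<open>f \<noteq> 0\<close> by (simp add: vec_eq_iff)
  qed
  fix x0
  have pos: "f $ y > 0" if "{x, y} \<in> E" "f $ x > 0" for x y
    using no_opposite[OF that(1)] that(2) nonzero[of y] by (auto simp: zero_le_mult_iff)
  have neg: "f $ y < 0" if "{x, y} \<in> E" "f $ x < 0" for x y
    using no_opposite[OF that(1)] that(2) nonzero[of y] by (auto simp: zero_le_mult_iff)
  have "f $ x0 > 0 \<or> f $ x0 < 0" using nonzero[of x0] by linarith
  then show ?thesis using connected_graph_induct[OF conn, of "\<lambda>x. f $ x > 0"] connected_graph_induct[OF conn, of "\<lambda>x. f $ x < 0"] pos neg by blast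
qed

section \<open>The largest variational eigenvalue\<close>

abbreviation (input) top_eigenvalue :: real
  where "top_eigenvalue \<equiv> variational_eigenvalue p E w \<mu> \<kappa> \<sigma> CARD('v)"

lemma top_eigenvalue_eq_SUP:
  "top_eigenvalue = (SUP f\<in>unit_p_sphere p \<mu>. rayleigh_quotient p E w \<mu> \<kappa> \<sigma> f)"
  unfolding variational_eigenvalue_def
  using p by (subst genus_family_top) (auto simp: vertex_weight_pos)

lemma excess_on_unit_p_sphere:
  "f \<in> unit_p_sphere p \<mu> \<Longrightarrow> excess p E w \<mu> \<kappa> ev f = rayleigh_quotient p E w \<mu> \<kappa> \<sigma> f - ev"
  by (simp add: unit_p_sphere_iff excess_def rayleigh_quotient_antibalanced)

text \<open>
  By homogeneity only the unit sphere matters. There the Rayleigh quotient is continuous on a compact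
  set, so its supremum is finite and bounds it.
\<close>

lemma excess_top_eigenvalue: "excess p E w \<mu> \<kappa> top_eigenvalue h \<le> 0"
proof (cases "h = 0")
  case True
  then show ?thesis by (simp add: excess_def edge_energy_def power_sum_def)
next
  case False
  let ?S = "unit_p_sphere p \<mu>"
  have \<mu>: "\<mu> x > 0" for x by (rule vertex_weight_pos)
  define a where "a = power_sum p \<mu> h powr (- 1 / p)"
  have a: "a *\<^sub>R h \<in> ?S" unfolding a_def using p False \<mu> by (intro normalized_in_unit_p_sphere) auto
  have "a > 0" unfolding a_def using power_sum_pos[of \<mu>, OF \<mu> False, of p] by simp
  have "continuous_on ?S (\<lambda>f. edge_energy p E w f + power_sum p \<kappa> f)"
    using p by (intro continuous_intros continuous_on_edge_energy) auto
  then have "continuous_on ?S (rayleigh_quotient p E w \<mu> \<kappa> \<sigma>)"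
    by (rule continuous_on_eq) (simp add: unit_p_sphere_iff rayleigh_quotient_antibalanced)
  then have "compact (rayleigh_quotient p E w \<mu> \<kappa> \<sigma> ` ?S)"
    using p \<mu> by (intro compact_continuous_image compact_unit_p_sphere) auto
  then have "bdd_above (rayleigh_quotient p E w \<mu> \<kappa> \<sigma> ` ?S)"
    by (intro bounded_imp_bdd_above compact_imp_bounded)
  then have "rayleigh_quotient p E w \<mu> \<kappa> \<sigma> (a *\<^sub>R h) \<le> top_eigenvalue"
    unfolding top_eigenvalue_eq_SUP using a by (intro cSUP_upper)
  then have "excess p E w \<mu> \<kappa> top_eigenvalue (a *\<^sub>R h) \<le> 0"
    by (simp add: excess_on_unit_p_sphere[OF a])
  then show ?thesis using \<open>a > 0\<close> by (simp add: excess_scaleR mult_le_0_iff)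
qed

lemma top_eigenvalue_unique:
  assumes "\<And>h. excess p E w \<mu> \<kappa> ev h \<le> 0" and "excess p E w \<mu> \<kappa> ev g = 0" "g \<noteq> 0"
  shows "ev = top_eigenvalue"
proof -
  have \<mu>: "\<mu> x > 0" for x by (rule vertex_weight_pos)
  have "excess p E w \<mu> \<kappa> top_eigenvalue g = (ev - top_eigenvalue) * power_sum p \<mu> g"
    using assms(2) by (simp add: excess_def algebra_simps)
  then have "ev \<le> top_eigenvalue"
    using excess_top_eigenvalue[of g] power_sum_pos[of \<mu>, OF \<mu> assms(3), of p]
    by (simp add: mult_le_0_iff)
  moreover have "top_eigenvalue \<le> ev"
    unfolding top_eigenvalue_eq_SUP
  proof (rule cSUP_least)
    show "unit_p_sphere p \<mu> \<noteq> {}"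
      using normalized_in_unit_p_sphere[of p \<mu> g] p \<mu> assms(3) by auto
    show "rayleigh_quotient p E w \<mu> \<kappa> \<sigma> f \<le> ev" if "f \<in> unit_p_sphere p \<mu>" for f
      using assms(1)[of f] excess_on_unit_p_sphere[OF that] by simp
  qed
  ultimately show ?thesis by simp
qed

lemma eigenfunction_make_positive:
  assumes "eigenfunction p E w \<mu> \<kappa> \<sigma> ev f" "(\<forall>x. f $ x > 0) \<or> (\<forall>x. f $ x < 0)"
  obtains s :: real where "s \<noteq> 0" "eigenfunction p E w \<mu> \<kappa> \<sigma> ev (s *\<^sub>R f)" "\<And>x. (s *\<^sub>R f) $ x > 0"
proof (cases "\<forall>x. f $ x > 0")
  case True
  then show ?thesis using assms that[of 1] by simp
next
  case False
  then show ?thesis using assms eigenfunction_uminus[OF assms(1)] that[of "-1"] by auto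
qed

lemma eigenvalue_of_signed_eigenfunction:
  assumes "eigenfunction p E w \<mu> \<kappa> \<sigma> ev g" "(\<forall>x. g $ x > 0) \<or> (\<forall>x. g $ x < 0)"
  shows "ev = top_eigenvalue"
proof -
  obtain s where s: "s \<noteq> 0" "eigenfunction p E w \<mu> \<kappa> \<sigma> ev (s *\<^sub>R g)" "\<And>x. (s *\<^sub>R g) $ x > 0"
    using eigenfunction_make_positive[OF assms] by blast
  show ?thesis
  proof (rule top_eigenvalue_unique)
    show "excess p E w \<mu> \<kappa> ev h \<le> 0" for h
      by (rule excess_nonpos[OF s(2,3)])
    show "excess p E w \<mu> \<kappa> ev (s *\<^sub>R g) = 0"
      by (rule excess_eigenfunction[OF s(2)])
    show "s *\<^sub>R g \<noteq> 0" using s(2) by (simp add: eigenfunction_def)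
  qed
qed

text \<open>
  All eigenfunctions for \<open>ev\<close> have excess \<open>0\<close>. Since \<open>f\<close> has a strict sign, the quotient of \<open>g\<close> and
  \<open>f\<close> is therefore constant along the edges, and the graph is connected.
\<close>

lemma eigenfunction_proportional:
  assumes conn: "connected_graph E"
    and f: "eigenfunction p E w \<mu> \<kappa> \<sigma> ev f" "(\<forall>x. f $ x > 0) \<or> (\<forall>x. f $ x < 0)"
    and g: "eigenfunction p E w \<mu> \<kappa> \<sigma> ev g"
  shows "\<exists>c. c \<noteq> 0 \<and> g = c *\<^sub>R f"
proof -
  obtain s where s: "s \<noteq> 0" "eigenfunction p E w \<mu> \<kappa> \<sigma> ev (s *\<^sub>R f)" "\<And>x. (s *\<^sub>R f) $ x > 0"
    using eigenfunction_make_positive[OF f] by blast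
  define q where "q = (\<lambda>x. g $ x / (s *\<^sub>R f) $ x)"
  have edge: "q x = q y" if "{x, y} \<in> E" for x y
    unfolding q_def
    by (rule excess_eq_0D[OF s(2,3) excess_eigenfunction[OF g] that])
  fix x0
  have "q x = q x0" for x
    by (rule connected_graph_induct[OF conn, of "\<lambda>x. q x = q x0"]) (use edge in auto)
  then have "g $ x = q x0 * (s *\<^sub>R f) $ x" for x
    using s(3)[of x] by (metis less_irrefl nonzero_eq_divide_eq q_def)
  then have "g = (q x0 * s) *\<^sub>R f" by (simp add: vec_eq_iff)
  moreover have "g \<noteq> 0" using g by (simp add: eigenfunction_def)
  ultimately show ?thesis by (metis scaleR_zero_left)
qed

end

theorem theorem9:
  fixes E :: "'v::finite set set"
    and w \<sigma> :: "'v set \<Rightarrow> real"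
    and \<mu> \<kappa> :: "'v \<Rightarrow> real"
    and p :: real and n :: nat
    and f :: "real ^ 'v"
  assumes "p > 1"
    and "weighted_signed_graph E w \<mu> \<sigma>"
    and "connected_graph E"
    and "\<forall>e\<in>E. \<sigma> e = -1"
    and "n = CARD('v)"
    and "eigenfunction p E w \<mu> \<kappa> \<sigma> (variational_eigenvalue p E w \<mu> \<kappa> \<sigma> n) f"
  shows "((\<forall>x. f $ x > 0) \<or> (\<forall>x. f $ x < 0))
    \<and> (\<forall>g. eigenfunction p E w \<mu> \<kappa> \<sigma> (variational_eigenvalue p E w \<mu> \<kappa> \<sigma> n) g
          \<longrightarrow> (\<exists>c. c \<noteq> 0 \<and> g = c *\<^sub>R f))
    \<and> (\<forall>g ev. eigenfunction p E w \<mu> \<kappa> \<sigma> ev g \<and> ((\<forall>x. g $ x > 0) \<or> (\<forall>x. g $ x < 0))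
          \<longrightarrow> ev = variational_eigenvalue p E w \<mu> \<kappa> \<sigma> n)"
proof -
  note ctx = assms(1,2,4)
  have f: "eigenfunction p E w \<mu> \<kappa> \<sigma> (variational_eigenvalue p E w \<mu> \<kappa> \<sigma> CARD('v)) f"
    using assms(5,6) by simp
  have sign: "(\<forall>x. f $ x > 0) \<or> (\<forall>x. f $ x < 0)"
  proof (rule excess_maximizer_same_sign[OF ctx assms(3) excess_top_eigenvalue[OF ctx]])
    show "excess p E w \<mu> \<kappa> (variational_eigenvalue p E w \<mu> \<kappa> \<sigma> CARD('v)) f = 0"
      by (rule excess_eigenfunction[OF ctx f])
    show "f \<noteq> 0" using f by (simp add: eigenfunction_def)
  qed
  show ?thesis
    unfolding assms(5)
    using sign eigenfunction_proportional[OF ctx assms(3) f sign]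
      eigenvalue_of_signed_eigenfunction[OF ctx] by blast
qed

end
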